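(* Let $C\in\mathbb R^{n\times n}$ and let $f\in C(\mathbb R\times\mathbb R^n,\mathbb R^n)$ satisfy $f(t,0)=0$ for all $t\in\mathbb R$. Let $\alpha$ and $\beta$ be respectively the minimum and the maximum of the real parts of the eigenvalues of $C$, and let $m_\alpha$ (resp. $m_\beta$) be the maximum of the degrees of the elementary divisors of $C$ corresponding to eigenvalues with real part equal to $\alpha$ (resp. $\beta$). Assume that there is a nonnegative function $\eta$ defined on $\mathbb R_+=[0,\infty)$ such that: 1. $\|f(t,x_1)-f(t,x_2)\|\le\eta(t)\|x_1-x_2\|$ for all $(t,x_1),(t,x_2)\in\mathbb R_+\times\mathbb R^n$; 2. $\displaystyle\int_0^\infty t^{m_\beta+m_\alpha-2}e^{(\beta-\alpha)t}\eta(t)\,dt<\infty$; 3. $\displaystyle\lim_{t\to\infty}\int_t^\infty (s-t)^{m_\alpha-1}s^{m_\beta-1}e^{\alpha(t-s)}e^{\beta s}\eta(s)\,ds=0$. Suppose that the system $x'=Cx$ has a $k$-parameter ($k\le n$) family $\gamma_1$ of almost periodic solutions. Then the system $y'=Cy+f(t,y)$ admits a $k$-parameter family $\gamma_2$ of asymptotically almost periodic solutions, and $\gamma_1$ is homeomorphic to $\gamma_2$.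
   Context: Here $x,y\in\mathbb R^n$, $\|\cdot\|$ is the Euclidean norm on $\mathbb R^n$, and $C(\mathbb X,\mathbb Y)$ denotes the space of all continuous functions defined on $\mathbb X$ with values in $\mathbb Y$ (while $C$ alone denotes the constant matrix). A number $\tau\in\mathbb R$ is called an $\epsilon$-translation number of a function $g\in C(\mathbb R,\mathbb R^n)$ if $\|g(t+\tau)-g(t)\|<\epsilon$ for all $t\in\mathbb R$. A function $g\in C(\mathbb R,\mathbb R^n)$ is called almost periodic if for every $\epsilon>0$ there exists a relatively dense set of $\epsilon$-translation numbers of $g$. A function $h\in C(\mathbb R,\mathbb R^n)$ is called asymptotically almost periodic if there are an almost periodic function $g$ and a function $\phi\in C(\mathbb R,\mathbb R^n)$ with $\lim_{t\to\infty}\phi(t)=0$ such that $h(t)=g(t)+\phi(t)$.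
   Formalization: Solutions of y'=Cy+f(t,y) are taken on [0,∞), as restrictions of asymptotically almost periodic functions on R; on all of R the claim fails (n=1, C=0, η=0, f=ty³ for t<0 and 0 for t≥0: nonzero solutions blow up backward). *)

theory Defs
  imports "HOL-Analysis.Analysis" "Jordan_Normal_Form.Jordan_Normal_Form"
begin

text \<open>The theory of Jordan normal forms works with matrices of type \<^typ>\<open>complex mat\<close>.
  The index type is enumerated by \<^const>\<open>from_nat_into\<close>, which restricts to a bijection from
  \<open>{..<CARD('n)}\<close> onto \<open>UNIV :: 'n set\<close>; another enumeration gives a similar matrix.\<close>

definition complex_mat_of :: "real^'n^'n \<Rightarrow> complex mat" where
  "complex_mat_of C = Matrix.mat CARD('n) CARD('n)
     (\<lambda>(i, j). complex_of_real
        (vec_nth (vec_nth C (from_nat_into UNIV i)) (from_nat_into UNIV j)))"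

definition eigenvalues :: "real^'n^'n \<Rightarrow> complex set" where
  "eigenvalues C = {\<mu>. eigenvalue (complex_mat_of C) \<mu>}"

text \<open>The elementary divisors over the complex numbers are the polynomials \<open>(X - \<mu>)^m\<close>, one for
  each Jordan block of size \<open>m\<close> with eigenvalue \<open>\<mu>\<close> (equivalently, for each cyclic summand
  \<open>\<complex>[X]/(X - \<mu>)^m\<close> of the \<open>\<complex>[X]\<close>-module defined by the matrix). They are collected as a set,
  without multiplicities; the Jordan normal form is unique up to the order of the blocks.\<close>

definition elementary_divisors :: "real^'n^'n \<Rightarrow> complex poly set" where
  "elementary_divisors C =
     {[:-\<mu>, 1:] ^ m | m \<mu>. \<exists>bs. jordan_nf (complex_mat_of C) bs \<and> (m, \<mu>) \<in> set bs}"

definition max_divisor_degree :: "real^'n^'n \<Rightarrow> real \<Rightarrow> nat" where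
  "max_divisor_degree C r =
     Max (degree ` {p \<in> elementary_divisors C. \<exists>\<mu>. poly p \<mu> = 0 \<and> Re \<mu> = r})"

definition solves_ode_on ::
    "real set \<Rightarrow> (real \<Rightarrow> 'a \<Rightarrow> 'a) \<Rightarrow> (real \<Rightarrow> 'a::real_normed_vector) \<Rightarrow> bool" where
  "solves_ode_on I F x \<longleftrightarrow> (\<forall>t\<in>I. (x has_vector_derivative F t (x t)) (at t within I))"

definition translation_number ::
    "real \<Rightarrow> (real \<Rightarrow> 'a::real_normed_vector) \<Rightarrow> real \<Rightarrow> bool" where
  "translation_number \<epsilon> g \<tau> \<longleftrightarrow> (\<forall>t. norm (g (t + \<tau>) - g t) < \<epsilon>)"

definition relatively_dense :: "real set \<Rightarrow> bool" where
  "relatively_dense T \<longleftrightarrow> (\<exists>l>0. \<forall>a. T \<inter> {a..a + l} \<noteq> {})"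

definition almost_periodic :: "(real \<Rightarrow> 'a::real_normed_vector) \<Rightarrow> bool" where
  "almost_periodic g \<longleftrightarrow> continuous_on UNIV g \<and>
     (\<forall>\<epsilon>>0. \<exists>T. relatively_dense T \<and> (\<forall>\<tau>\<in>T. translation_number \<epsilon> g \<tau>))"

definition asymptotically_almost_periodic :: "(real \<Rightarrow> 'a::real_normed_vector) \<Rightarrow> bool" where
  "asymptotically_almost_periodic h \<longleftrightarrow>
     (\<exists>g \<phi>. almost_periodic g \<and> continuous_on UNIV \<phi> \<and> (\<phi> \<longlongrightarrow> 0) at_top \<and>
            (\<forall>t. h t = g t + \<phi> t))"

text \<open>A function on \<open>S\<close> is represented by its extensional representative, so that two functions
  that agree on \<open>S\<close> are identified. On \<open>C(S, \<real>\<^sup>n)\<close> the compact-open topology is that of uniform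
  convergence on compact subsets of \<open>S\<close>.\<close>

definition continuous_functions ::
    "'a::topological_space set \<Rightarrow> ('a \<Rightarrow> 'b::topological_space) set" where
  "continuous_functions S = {x \<in> extensional S. continuous_on S x}"

definition compact_open_topology ::
    "'a::topological_space set \<Rightarrow> ('a \<Rightarrow> 'b::topological_space) topology" where
  "compact_open_topology S = topology_generated_by
     {{x \<in> continuous_functions S. x ` K \<subseteq> U} | K U. compact K \<and> K \<subseteq> S \<and> open U}"

text \<open>The parameters range over a nonempty open subset of \<open>\<real>\<^sup>k\<close>, and different parameters give
  different members of the family.\<close>

definition parameter_family :: "nat \<Rightarrow> 'a topology \<Rightarrow> 'a set \<Rightarrow> bool" where
  "parameter_family k X \<Gamma> \<longleftrightarrow>
     (\<exists>P u. openin (Euclidean_space k) P \<and> P \<noteq> {} \<and>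
            continuous_map (subtopology (Euclidean_space k) P) X u \<and> inj_on u P \<and> u ` P = \<Gamma>)"

definition ap_solutions :: "(real \<Rightarrow> 'a \<Rightarrow> 'a) \<Rightarrow> (real \<Rightarrow> 'a::real_normed_vector) set" where
  "ap_solutions F = {x. solves_ode_on UNIV F x \<and> almost_periodic x}"

text \<open>The perturbed system is only controlled for nonnegative times (for negative times its
  solutions need not exist), so its solutions are functions on \<open>[0,\<infinity>)\<close>. Such a function is
  asymptotically almost periodic if it is the restriction of an asymptotically almost periodic
  function on \<open>\<real>\<close>.\<close>

definition aap_solutions :: "(real \<Rightarrow> 'a \<Rightarrow> 'a) \<Rightarrow> (real \<Rightarrow> 'a::real_normed_vector) set" where
  "aap_solutions F = {y. solves_ode_on {0..} F y \<and>
     (\<exists>h. asymptotically_almost_periodic h \<and> y = restrict h {0..})}"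

end

theory Submission
  imports Defs "Jordan_Normal_Form.Jordan_Normal_Form_Existence"
begin

text \<open>The idea is to attach to a bounded solution \<open>t \<mapsto> X(t)a\<close> of the linear system, where
  \<open>X\<close> is its flow, the solution of the perturbed system that is asymptotic to it, that is, the
  solution of the integral equation
  \<open>y(t) = X(t)a - \<integral>\<^sub>t\<^sup>\<infinity> X(t-s) f(s,y(s)) ds\<close>.

  A nonzero bounded solution on \<open>\<real>\<close> forces \<open>\<alpha> \<le> 0 \<le> \<beta>\<close>, since otherwise \<open>X\<close> decays in
  one time direction. The Jordan form then gives
  \<open>\<parallel>X(t-s)\<parallel> \<le> L (1+s)^(m\<^sub>\<beta>+m\<^sub>\<alpha>-2) e^((\<beta>-\<alpha>)s)\<close> for \<open>0 \<le> t \<le> s\<close>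
  (\<open>flow_backward_bound\<close>), so the integrand is Lipschitz in \<open>y(s)\<close> with a constant \<open>w(s)\<close> that is
  independent of \<open>t\<close>, and \<open>w\<close> is integrable on every \<open>[d,\<infinity>)\<close> with \<open>d > 0\<close>. With
  \<open>p(t) = exp(4 \<integral>\<^sub>t\<^sup>\<infinity> w)\<close> one has \<open>\<integral>\<^sub>t\<^sup>\<infinity> w p \<le> (p(t)-1)/2\<close>, so the integral operator
  is a contraction with factor \<open>1/2\<close> in the norm \<open>sup \<parallel>y(t)\<parallel>/p(t)\<close> on the whole of
  \<open>(0,\<infinity>)\<close> (\<open>exists_fixed_point\<close>). The same inequality shows that the fixed points for \<open>a\<close> and
  \<open>b\<close> differ by \<open>X(t)(a-b)\<close>, up to an error of at most \<open>p(t)-1\<close> times the supremum of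
  \<open>\<parallel>X(t)(a-b)\<parallel>\<close> (\<open>sol_diff_flow_bound\<close>), and \<open>p(t)\<close> tends to \<open>1\<close>. Hence \<open>y\<close> is asymptotic to
  \<open>X(t)a\<close>, and \<open>a\<close> can be recovered continuously from the value of \<open>y\<close> at one late time.

  The function \<open>\<eta>\<close> need not be integrable at \<open>0\<close>: only \<open>t^(m\<^sub>\<beta>+m\<^sub>\<alpha>-2) \<eta>(t)\<close> is. A solution
  on \<open>(0,\<infinity>)\<close> may therefore blow up as \<open>t\<close> decreases to \<open>0\<close>; for instance,
  if \<open>m\<^sub>\<beta>+m\<^sub>\<alpha> > 2\<close>, the hypotheses allow \<open>f(t,y) = - y/t\<close> for small \<open>t\<close> and \<open>t \<parallel>y\<parallel> \<ge> 1\<close>. Small solutions cannot,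
  because \<open>f\<close> is continuous and hence bounded near \<open>t = 0\<close>
  (\<open>ode_trapped_in_ball\<close>). This is enough: the map \<open>v \<mapsto> r v / (1 + \<parallel>v\<parallel>)\<close> shrinks the initial
  values of \<open>\<gamma>\<^sub>1\<close> homeomorphically into a small ball, and as it only rescales each
  vector, it preserves almost periodicity of the corresponding solutions. The
  homeomorphism of the theorem is the composition of three: from \<open>\<gamma>\<^sub>1\<close> to its
  initial values, to the shrunk initial values, to the solutions of the perturbed system.\<close>

no_notation scalar_prod (infix "\<bullet>" 70)

section \<open>Function spaces with the compact-open topology\<close>

text \<open>The compact set \<open>{}\<close> makes the whole function space one of the subbasic sets.\<close>

lemma topspace_compact_open [simp]:
  "topspace (compact_open_topology S) = continuous_functions S"
proof -
  have "continuous_functions S \<subseteq> \<Union>{{x \<in> continuous_functions S. x ` K \<subseteq> U} | K U.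
           compact K \<and> K \<subseteq> S \<and> open U}"
    by (rule Union_upper) (auto intro!: exI[of _ "{}"])
  then show ?thesis
    unfolding compact_open_topology_def topology_generated_by_topspace by blast
qed

lemma continuous_map_compact_open_eval:
  assumes "t \<in> S"
  shows "continuous_map (compact_open_topology S) euclidean (\<lambda>x. x t)"
  unfolding continuous_map_alt
proof (intro conjI allI impI)
  fix U :: "'b set"
  assume "openin euclidean U"
  then have "open U" by simp
  then have "openin (compact_open_topology S) {x \<in> continuous_functions S. x ` {t} \<subseteq> U}"
    unfolding compact_open_topology_def
    using assms by (intro topology_generated_by_Basis CollectI exI[of _ "{t}"] exI[of _ U]) auto
  then show "openin (compact_open_topology S)
      ((\<lambda>x. x t) -` U \<inter> topspace (compact_open_topology S))"
    by (simp add: vimage_def Int_def conj_commute)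
qed auto

lemma continuous_map_into_compact_open:
  fixes Y :: "'a::metric_space \<Rightarrow> 'b::topological_space \<Rightarrow> 'c::metric_space"
  assumes Y: "\<And>a. a \<in> A \<Longrightarrow> Y a \<in> continuous_functions S"
    and unif: "\<And>a K \<epsilon>. a \<in> A \<Longrightarrow> compact K \<Longrightarrow> K \<subseteq> S \<Longrightarrow> \<epsilon> > 0 \<Longrightarrow>
      \<exists>\<delta>>0. \<forall>b\<in>A. dist a b < \<delta> \<longrightarrow> (\<forall>t\<in>K. dist (Y a t) (Y b t) < \<epsilon>)"
  shows "continuous_map (top_of_set A) (compact_open_topology S) Y"
  unfolding compact_open_topology_def continuous_on_generated_topo_iff
proof (intro conjI allI impI)
  fix V :: "('b \<Rightarrow> 'c) set"
  assume "V \<in> {{x \<in> continuous_functions S. x ` K \<subseteq> U} | K U. compact K \<and> K \<subseteq> S \<and> open U}"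
  then obtain K U where V: "V = {x \<in> continuous_functions S. x ` K \<subseteq> U}"
    and K: "compact K" "K \<subseteq> S" and U: "open U" by blast
  have "\<exists>\<delta>>0. \<forall>b\<in>A. dist b a < \<delta> \<longrightarrow> b \<in> Y -` V \<inter> A" if a: "a \<in> Y -` V \<inter> A" for a
  proof -
    have "compact (Y a ` K)"
      using a K Y[of a] unfolding continuous_functions_def
      by (intro compact_continuous_image) (auto intro: continuous_on_subset)
    then obtain \<epsilon> where \<epsilon>: "\<epsilon> > 0" "(\<Union>z\<in>Y a ` K. ball z \<epsilon>) \<subseteq> U"
      using compact_subset_open_imp_ball_epsilon_subset[of "Y a ` K" U] U a V by blast
    obtain \<delta> where \<delta>: "\<delta> > 0" "\<And>b t. b \<in> A \<Longrightarrow> dist a b < \<delta> \<Longrightarrow> t \<in> K \<Longrightarrow> dist (Y a t) (Y b t) < \<epsilon>"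
      using unif[of a K \<epsilon>] a K \<epsilon> by blast
    have "b \<in> Y -` V \<inter> A" if "b \<in> A" "dist b a < \<delta>" for b
      using \<delta>(2)[of b] that \<epsilon>(2) Y[of b] by (force simp: V dist_commute)
    then show ?thesis using \<delta>(1) by blast
  qed
  then show "openin (top_of_set A) (Y -` V \<inter> topspace (top_of_set A))"
    unfolding openin_euclidean_subtopology_iff by auto
next
  show "Y ` topspace (top_of_set A) \<subseteq> \<Union>{{x \<in> continuous_functions S. x ` K \<subseteq> U} | K U.
           compact K \<and> K \<subseteq> S \<and> open U}"
    using Y topspace_compact_open[of S, where 'b='c]
    unfolding compact_open_topology_def topology_generated_by_topspace by auto
qed

text \<open>The criterion by which families of solutions are recognized as homeomorphic to their sets of
  parameters: continuous dependence, locally uniform in time, gives one direction, and a Lipschitz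
  recovery of the parameter from the value at a single time \<open>T\<close> gives the other, because
  evaluation at \<open>T\<close> is continuous.\<close>

lemma homeomorphic_image_compact_open:
  fixes Y :: "'a::metric_space \<Rightarrow> 'b::topological_space \<Rightarrow> 'c::metric_space"
  assumes Y: "\<And>a. a \<in> A \<Longrightarrow> Y a \<in> continuous_functions S"
    and unif: "\<And>a K \<epsilon>. a \<in> A \<Longrightarrow> compact K \<Longrightarrow> K \<subseteq> S \<Longrightarrow> \<epsilon> > 0 \<Longrightarrow>
      \<exists>\<delta>>0. \<forall>b\<in>A. dist a b < \<delta> \<longrightarrow> (\<forall>t\<in>K. dist (Y a t) (Y b t) < \<epsilon>)"
    and T: "T \<in> S"
    and lower: "\<And>a b. a \<in> A \<Longrightarrow> b \<in> A \<Longrightarrow> dist a b \<le> L * dist (Y a T) (Y b T)"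
  shows "top_of_set A homeomorphic_space subtopology (compact_open_topology S) (Y ` A)"
proof -
  define e where "e a = Y a T" for a
  define g where "g = inv_into A e"
  have inj: "inj_on e A"
    using lower by (force simp: inj_on_def e_def)
  have g: "g (e a) = a" if "a \<in> A" for a
    using inv_into_f_f[OF inj that] by (simp add: g_def)
  have L: "dist a b \<le> (\<bar>L\<bar> + 1) * dist (e a) (e b)" if "a \<in> A" "b \<in> A" for a b
  proof -
    have "L * dist (e a) (e b) \<le> (\<bar>L\<bar> + 1) * dist (e a) (e b)"
      by (rule mult_right_mono) auto
    then show ?thesis using lower[OF that] by (simp only: e_def)
  qed
  have "(\<bar>L\<bar> + 1)-lipschitz_on (e ` A) g"
    by (rule lipschitz_onI) (auto simp: g L)
  then have gc: "continuous_on (e ` A) g"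
    by (rule lipschitz_on_continuous_on)
  have ev: "continuous_map (subtopology (compact_open_topology S) (Y ` A)) (top_of_set (e ` A)) (\<lambda>x. x T)"
    unfolding continuous_map_in_subtopology
    using continuous_map_from_subtopology[OF continuous_map_compact_open_eval[OF T], of "Y ` A"]
    by (auto simp: e_def)
  have "continuous_map (top_of_set (e ` A)) (top_of_set A) g"
    using gc by (auto simp: g)
  then have "continuous_map (subtopology (compact_open_topology S) (Y ` A)) (top_of_set A) (g \<circ> (\<lambda>x. x T))"
    by (rule continuous_map_compose[OF ev])
  moreover have "continuous_map (top_of_set A) (subtopology (compact_open_topology S) (Y ` A)) Y"
    using continuous_map_into_compact_open[OF Y unif]
    by (auto simp: continuous_map_in_subtopology)
  ultimately have "homeomorphic_maps (top_of_set A) (subtopology (compact_open_topology S) (Y ` A)) Y (g \<circ> (\<lambda>x. x T))"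
    unfolding homeomorphic_maps_def using g by (auto simp: e_def)
  then show ?thesis
    unfolding homeomorphic_space_def by blast
qed

lemma parameter_family_homeomorphic:
  assumes fam: "parameter_family k X \<Gamma>"
    and hom: "subtopology X \<Gamma> homeomorphic_space subtopology Y \<Delta>"
    and "\<Delta> \<subseteq> topspace Y"
  shows "parameter_family k Y \<Delta>"
proof -
  obtain P u where P: "openin (Euclidean_space k) P" "P \<noteq> {}"
    and u: "continuous_map (subtopology (Euclidean_space k) P) X u" "inj_on u P" "u ` P = \<Gamma>"
    using fam unfolding parameter_family_def by blast
  have tP: "topspace (subtopology (Euclidean_space k) P) = P"
    using openin_subset[OF P(1)] by auto
  have \<Gamma>: "topspace (subtopology X \<Gamma>) = \<Gamma>"
    using continuous_map_image_subset_topspace[OF u(1)] u(3) tP by auto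
  have \<Delta>: "topspace (subtopology Y \<Delta>) = \<Delta>"
    using assms(3) by auto
  obtain h where h: "homeomorphic_map (subtopology X \<Gamma>) (subtopology Y \<Delta>) h"
    using hom homeomorphic_space by blast
  have hb: "h ` \<Gamma> = \<Delta>" "inj_on h \<Gamma>"
    using homeomorphic_imp_surjective_map[OF h] homeomorphic_imp_injective_map[OF h]
    unfolding \<Gamma> \<Delta> by auto
  have "continuous_map (subtopology (Euclidean_space k) P) (subtopology X \<Gamma>) u"
    using u tP by (auto simp: continuous_map_in_subtopology)
  then have "continuous_map (subtopology (Euclidean_space k) P) (subtopology Y \<Delta>) (h \<circ> u)"
    using continuous_map_compose homeomorphic_imp_continuous_map[OF h] by blast
  then have "continuous_map (subtopology (Euclidean_space k) P) Y (h \<circ> u)"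
    by (simp add: continuous_map_in_subtopology)
  moreover have "inj_on (h \<circ> u) P" "(h \<circ> u) ` P = \<Delta>"
    using comp_inj_on[OF u(2)] hb u(3) by (auto simp: image_comp[symmetric])
  ultimately show ?thesis
    unfolding parameter_family_def using P by blast
qed

text \<open>The map is injective with inverse \<open>u \<mapsto> u / (r - \<parallel>u\<parallel>)\<close>, since
  \<open>r - \<parallel>u\<parallel> = r / (1 + \<parallel>v\<parallel>)\<close> for the image \<open>u\<close> of \<open>v\<close>.\<close>

lemma homeomorphic_shrink_into_ball:
  fixes S :: "'a::real_normed_vector set"
  assumes r: "r > 0"
  shows "top_of_set S homeomorphic_space
    top_of_set ((\<lambda>v. (r / (1 + norm v)) *\<^sub>R v) ` S)"
proof -
  define s :: "'a \<Rightarrow> 'a" where "s v = (r / (1 + norm v)) *\<^sub>R v" for v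
  define s' :: "'a \<Rightarrow> 'a" where "s' v = (1 / (r - norm v)) *\<^sub>R v" for v
  have ns: "r - norm (s v) = r / (1 + norm v)" for v
  proof -
    have "1 + norm v > 0" using norm_ge_zero[of v] by linarith
    moreover from this have "norm (s v) = r / (1 + norm v) * norm v" using r by (simp add: s_def)
    ultimately show ?thesis by (simp add: field_simps)
  qed
  have pos: "1 + norm v > 0" for v :: 'a
    using norm_ge_zero[of v] by linarith
  have s's: "s' (s v) = v" for v
    unfolding s'_def ns using r pos[of v] by (simp add: s_def)
  have "continuous_on S s"
    unfolding s_def using pos by (intro continuous_intros) (metis less_irrefl)
  moreover have "continuous_on (s ` S) s'"
  proof -
    have "r - norm w \<noteq> 0" if w: "w \<in> s ` S" for w
    proof -
      obtain v where "w = s v" using w by blast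
      then show ?thesis using ns[of v] divide_pos_pos[OF r pos[of v]] by (metis less_irrefl)
    qed
    then show ?thesis
      unfolding s'_def by (intro continuous_intros) auto
  qed
  ultimately have "homeomorphic_maps (top_of_set S) (top_of_set (s ` S)) s s'"
    unfolding homeomorphic_maps_def using s's by auto
  then show ?thesis unfolding homeomorphic_space_def s_def by blast
qed

section \<open>Almost periodic functions\<close>

text \<open>Every time can be translated into a fixed compact interval by a \<open>1\<close>-translation number.\<close>

lemma almost_periodic_bounded:
  assumes "almost_periodic g"
  shows "\<exists>B. \<forall>t. norm (g t) \<le> B"
proof -
  have "\<exists>T. relatively_dense T \<and> (\<forall>\<tau>\<in>T. translation_number 1 g \<tau>)"
    using assms by (simp add: almost_periodic_def)
  then obtain T where T: "relatively_dense T" "\<And>\<tau>. \<tau> \<in> T \<Longrightarrow> translation_number 1 g \<tau>"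
    by blast
  obtain l where l: "l > 0" "\<And>a. T \<inter> {a..a + l} \<noteq> {}"
    using T(1) unfolding relatively_dense_def by blast
  have "compact (g ` {0..l})"
    using assms unfolding almost_periodic_def
    by (intro compact_continuous_image) (auto intro: continuous_on_subset)
  then obtain B where B: "\<And>t. t \<in> {0..l} \<Longrightarrow> norm (g t) \<le> B"
    using compact_imp_bounded bounded_iff by (metis imageI)
  have "norm (g t) \<le> B + 1" for t
  proof -
    obtain \<tau> where \<tau>: "\<tau> \<in> T" "\<tau> \<in> {-t..-t + l}" using l(2)[of "-t"] by blast
    have "norm (g (t + \<tau>) - g t) < 1"
      using T(2)[OF \<tau>(1)] by (simp add: translation_number_def)
    moreover have "norm (g (t + \<tau>)) \<le> B" using \<tau>(2) by (intro B) auto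
    ultimately show ?thesis by norm
  qed
  then show ?thesis by blast
qed

lemma almost_periodic_scaleR:
  assumes "almost_periodic g"
  shows "almost_periodic (\<lambda>t. c *\<^sub>R g t)"
  unfolding almost_periodic_def
proof (intro conjI allI impI)
  show "continuous_on UNIV (\<lambda>t. c *\<^sub>R g t)"
    using assms unfolding almost_periodic_def by (intro continuous_intros) auto
next
  fix \<epsilon> :: real
  assume "\<epsilon> > 0"
  then have "\<epsilon> / (\<bar>c\<bar> + 1) > 0" by auto
  then obtain T where T: "relatively_dense T" "\<forall>\<tau>\<in>T. translation_number (\<epsilon> / (\<bar>c\<bar> + 1)) g \<tau>"
    using assms unfolding almost_periodic_def by blast
  have "translation_number \<epsilon> (\<lambda>t. c *\<^sub>R g t) \<tau>" if "\<tau> \<in> T" for \<tau>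
    unfolding translation_number_def
  proof
    fix t
    have "norm (g (t + \<tau>) - g t) < \<epsilon> / (\<bar>c\<bar> + 1)"
      using T(2) that by (simp add: translation_number_def)
    then have "(\<bar>c\<bar> + 1) * norm (g (t + \<tau>) - g t) < \<epsilon>"
      by (simp add: pos_less_divide_eq mult.commute add_nonneg_pos)
    moreover have "norm (c *\<^sub>R g (t + \<tau>) - c *\<^sub>R g t) = \<bar>c\<bar> * norm (g (t + \<tau>) - g t)"
      by (metis norm_scaleR scaleR_diff_right)
    ultimately show "norm (c *\<^sub>R g (t + \<tau>) - c *\<^sub>R g t) < \<epsilon>"
      by (smt (verit) mult_right_mono norm_ge_zero)
  qed
  then show "\<exists>T. relatively_dense T \<and> (\<forall>\<tau>\<in>T. translation_number \<epsilon> (\<lambda>t. c *\<^sub>R g t) \<tau>)"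
    using T(1) by blast
qed

text \<open>The remainder \<open>y - g\<close> is continued to negative times by its value at \<open>0\<close>.\<close>

lemma asymptotically_almost_periodic_restrict:
  fixes y :: "real \<Rightarrow> 'a::real_normed_vector"
  assumes g: "almost_periodic g" and y: "continuous_on {0..} y" "y \<in> extensional {0..}"
    and lim: "((\<lambda>t. y t - g t) \<longlongrightarrow> 0) at_top"
  shows "\<exists>h. asymptotically_almost_periodic h \<and> y = restrict h {0..}"
proof -
  define \<phi> where "\<phi> t = y (max t 0) - g (max t 0)" for t
  have gc: "continuous_on UNIV g" using g by (simp add: almost_periodic_def)
  have "continuous_on UNIV \<phi>"
    unfolding \<phi>_def
    by (intro continuous_on_diff continuous_on_compose2[OF y(1)] continuous_on_compose2[OF gc]
        continuous_intros) auto
  moreover have "(\<phi> \<longlongrightarrow> 0) at_top"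
  proof (rule Lim_transform_eventually[OF lim])
    show "eventually (\<lambda>t. y t - g t = \<phi> t) at_top"
      using eventually_ge_at_top[of 0] by eventually_elim (simp add: \<phi>_def)
  qed
  ultimately have "asymptotically_almost_periodic (\<lambda>t. g t + \<phi> t)"
    unfolding asymptotically_almost_periodic_def using g by blast
  moreover have "y = restrict (\<lambda>t. g t + \<phi> t) {0..}"
    using y(2) by (auto simp: \<phi>_def extensional_def restrict_def fun_eq_iff)
  ultimately show ?thesis by blast
qed

lemma solves_ode_on_continuous_on: "solves_ode_on I F y \<Longrightarrow> continuous_on I y"
  using has_vector_derivative_continuous
  unfolding solves_ode_on_def continuous_on_eq_continuous_within by blast

text \<open>If \<open>\<gamma>\<^sub>1\<close> consists of the zero solution alone, nothing is known about the signs of \<open>\<alpha>\<close> and \<open>\<beta>\<close>, so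
  that the integral equation is not available. This case is therefore treated separately.\<close>

lemma zero_solution_family:
  fixes F :: "real \<Rightarrow> 'a::euclidean_space \<Rightarrow> 'a"
  assumes F: "\<And>t. F t 0 = 0"
  shows "{restrict (\<lambda>_. 0) {0..}} \<subseteq> aap_solutions F"
    and "subtopology (compact_open_topology UNIV) {\<lambda>_ :: real. 0 :: 'a}
       homeomorphic_space subtopology (compact_open_topology {0..}) {restrict (\<lambda>_ :: real. 0 :: 'a) {0..}}"
proof -
  let ?z = "restrict (\<lambda>_ :: real. 0 :: 'a) {0..}"
  have sol: "solves_ode_on {0..} F ?z"
    unfolding solves_ode_on_def
  proof
    fix t :: real assume t: "t \<in> {0..}"
    have "(?z has_vector_derivative 0) (at t within {0..})"
      by (rule has_vector_derivative_transform[OF t _ has_vector_derivative_const[of 0]]) simp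
    then show "(?z has_vector_derivative F t (?z t)) (at t within {0..})" using t F by simp
  qed
  have "relatively_dense UNIV"
    unfolding relatively_dense_def by (intro exI[of _ 1]) auto
  then have ap: "almost_periodic (\<lambda>_ :: real. 0 :: 'a)"
    unfolding almost_periodic_def translation_number_def by auto
  have "\<exists>h. asymptotically_almost_periodic h \<and> ?z = restrict h {0..}"
  proof (rule asymptotically_almost_periodic_restrict[OF ap solves_ode_on_continuous_on[OF sol]])
    show "((\<lambda>t. ?z t - 0) \<longlongrightarrow> 0) at_top"
      by (rule tendsto_eventually, rule eventually_mono[OF eventually_ge_at_top[of 0]]) simp
  qed simp
  then show "{?z} \<subseteq> aap_solutions F"
    using sol unfolding aap_solutions_def by blast
  have "top_of_set {0::real} homeomorphic_space
      subtopology (compact_open_topology UNIV) ((\<lambda>_ _. 0) ` {0 :: real} :: (real \<Rightarrow> 'a) set)"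
    by (rule homeomorphic_image_compact_open[where T = 0 and L = 1])
      (auto simp: continuous_functions_def intro!: exI[of _ 1])
  moreover have "top_of_set {0::real} homeomorphic_space
      subtopology (compact_open_topology {0..}) ((\<lambda>_. ?z) ` {0 :: real})"
    by (rule homeomorphic_image_compact_open[where T = 0 and L = 1])
      (use solves_ode_on_continuous_on[OF sol] in \<open>auto simp: continuous_functions_def intro!: exI[of _ 1]\<close>)
  ultimately show "subtopology (compact_open_topology UNIV) {\<lambda>_ :: real. 0 :: 'a}
       homeomorphic_space subtopology (compact_open_topology {0..}) {?z}"
    using homeomorphic_space_trans[OF homeomorphic_space_sym[THEN iffD1]] by simp
qed

section \<open>A weight adapted to an integrable tail\<close>

lemma absolutely_integrable_from:
  fixes w :: "real \<Rightarrow> real"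
  assumes "w integrable_on {d..}" "\<And>s. s \<ge> d \<Longrightarrow> w s \<ge> 0"
  shows "w absolutely_integrable_on {d..}"
  using assms by (intro nonnegative_absolutely_integrable_1) auto

lemma tendsto_integral_at_top:
  fixes w :: "real \<Rightarrow> real"
  assumes "w integrable_on {a..}" "\<And>s. s \<ge> a \<Longrightarrow> w s \<ge> 0"
  shows "((\<lambda>b. integral {a..b} w) \<longlongrightarrow> integral {a..} w) at_top"
proof -
  note ai = absolutely_integrable_from[OF assms]
  have "((\<lambda>b. LINT s:{a..b}|lebesgue. w s) \<longlongrightarrow> (LINT s:{a..}|lebesgue. w s)) at_top"
    using ai by (intro tendsto_set_lebesgue_integral_at_top) auto
  moreover have "(LINT s:{a..b}|lebesgue. w s) = integral {a..b} w" for b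
    by (rule set_lebesgue_integral_eq_integral, rule set_integrable_subset[OF ai]) auto
  ultimately show ?thesis
    using set_lebesgue_integral_eq_integral(2)[OF ai] by simp
qed

text \<open>The rate \<open>w\<close> bounds the Lipschitz constant of the integral kernel; it may fail to be integrable
  at \<open>0\<close>.\<close>

locale integrable_tail =
  fixes w :: "real \<Rightarrow> real"
  assumes rate_integrable: "\<And>d. d > 0 \<Longrightarrow> w integrable_on {d..}"
    and rate_nonneg: "\<And>t. t > 0 \<Longrightarrow> w t \<ge> 0"
begin

definition tail_mass :: "real \<Rightarrow> real" where "tail_mass t = integral {t..} w"

text \<open>The weight of the norm in which the integral operator contracts. The factor \<open>4\<close> leaves room for
  the factor \<open>2\<close> that is lost in the local estimate of \<open>weighted_rate_interval_bound\<close>.\<close>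

definition weight :: "real \<Rightarrow> real" where "weight t = exp (4 * tail_mass t)"

lemma rate_integrable_interval: "0 < a \<Longrightarrow> w integrable_on {a..b}"
  using integrable_on_subinterval[OF rate_integrable[of a], of a b] by (simp add: subset_iff)

lemma tail_mass_split: 
  assumes "0 < a" "a \<le> b"
  shows "tail_mass a = integral {a..b} w + tail_mass b"
proof -
  have eq: "{a..b} \<union> {b..} = {a..}" using assms by auto
  have "negligible ({a..b} \<inter> {b..})"
    by (rule negligible_subset[of "{b}"]) (use assms in auto)
  then have "(w has_integral (integral {a..b} w + integral {b..} w)) ({a..b} \<union> {b..})"
    using assms by (intro has_integral_Un integrable_integral rate_integrable_interval rate_integrable) auto
  then show ?thesis
    unfolding tail_mass_def eq by (rule integral_unique)
qed

lemma tail_mass_nonneg: "0 < t \<Longrightarrow> tail_mass t \<ge> 0"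
  unfolding tail_mass_def using rate_integrable[of t] rate_nonneg by (intro integral_nonneg) auto

lemma tail_mass_antimono: "0 < a \<Longrightarrow> a \<le> b \<Longrightarrow> tail_mass b \<le> tail_mass a"
  using tail_mass_split[of a b] rate_integrable_interval[of a b] rate_nonneg integral_nonneg[of w "{a..b}"] by auto

lemma tail_mass_continuous: "continuous_on {0<..} tail_mass"
proof -
  have "continuous (at x) tail_mass" if x: "x \<in> {0<..}" for x :: real
  proof -
    have "continuous_on {x/2..x+1} (\<lambda>t. tail_mass (x/2) - integral {x/2..t} w)"
      using x by (intro continuous_intros indefinite_integral_continuous_1 rate_integrable_interval) auto
    then have "continuous_on {x/2..x+1} tail_mass"
      by (rule continuous_on_cong[THEN iffD1, rotated -1]) (use x tail_mass_split[of "x/2"] in auto)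
    then show ?thesis
      using x by (intro continuous_on_interior[of "{x/2..x+1}"]) auto
  qed
  then show ?thesis
    by (simp add: continuous_at_imp_continuous_on)
qed

lemma tail_mass_tendsto_0: "(tail_mass \<longlongrightarrow> 0) at_top"
proof -
  have "((\<lambda>b. integral {1..b} w) \<longlongrightarrow> integral {1..} w) at_top"
    by (rule tendsto_integral_at_top) (use rate_integrable[of 1] rate_nonneg in auto)
  then have "((\<lambda>b. tail_mass 1 - integral {1..b} w) \<longlongrightarrow> tail_mass 1 - tail_mass 1) at_top"
    unfolding tail_mass_def by (intro tendsto_intros)
  then have "((\<lambda>b. tail_mass 1 - integral {1..b} w) \<longlongrightarrow> 0) at_top" by simp
  moreover have "eventually (\<lambda>b. tail_mass 1 - integral {1..b} w = tail_mass b) at_top"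
    using eventually_ge_at_top[of 1] by eventually_elim (use tail_mass_split[of 1] in auto)
  ultimately show ?thesis
    by (rule Lim_transform_eventually)
qed

lemma weight_pos: "weight t > 0" by (simp add: weight_def)
lemma weight_ge_1: "0 < t \<Longrightarrow> weight t \<ge> 1" using tail_mass_nonneg[of t] by (simp add: weight_def)
lemma weight_antimono: "0 < a \<Longrightarrow> a \<le> b \<Longrightarrow> weight b \<le> weight a" using tail_mass_antimono[of a b] by (simp add: weight_def)
lemma weight_continuous: "continuous_on {0<..} weight"
  unfolding weight_def by (intro continuous_intros tail_mass_continuous)
lemma weight_tendsto_1: "(weight \<longlongrightarrow> 1) at_top"
  unfolding weight_def using tendsto_exp[OF tendsto_mult[OF tendsto_const[of 4] tail_mass_tendsto_0]] by simp

lemma weighted_rate_integrable: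
  assumes "0 < t"
  shows "(\<lambda>s. w s * weight s) integrable_on {t..}"
proof -
  have "(\<lambda>s. weight s * w s) absolutely_integrable_on {t..}"
  proof (rule absolutely_integrable_bounded_measurable_product_real)
    show "weight \<in> borel_measurable (lebesgue_on {t..})"
      using assms by (intro continuous_imp_measurable_on_sets_lebesgue continuous_on_subset[OF weight_continuous]) auto
    show "bounded (weight ` {t..})"
      using assms weight_antimono[of t] weight_pos by (intro boundedI[of _ "weight t"]) (auto simp: less_imp_le)
    show "w absolutely_integrable_on {t..}"
      using assms rate_integrable rate_nonneg by (intro absolutely_integrable_from) auto
  qed auto
  then show ?thesis
    by (simp add: mult.commute set_lebesgue_integral_eq_integral(1))
qed

text \<open>Formally \<open>weight' = - 4 w weight\<close>, so that the integral is \<open>(weight a - weight b) / 4\<close>. As \<open>w\<close> is merely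
  integrable, \<open>tail_mass\<close> need not be differentiable. Instead, the inequality is additive in the
  interval and holds with the constant \<open>1/2\<close> on intervals that are so short that \<open>weight\<close> varies
  by a factor of at most \<open>2\<close>; Bolzano's lemma turns this into the inequality on all intervals.\<close>

lemma weighted_rate_interval_bound:
  assumes "0 < a" "a \<le> b"
  shows "2 * integral {a..b} (\<lambda>s. w s * weight s) \<le> weight a - weight b"
proof -
  let ?P = "\<lambda>c d. a \<le> c \<longrightarrow> 2 * integral {c..d} (\<lambda>s. w s * weight s) \<le> weight c - weight d"
  have int: "(\<lambda>s. w s * weight s) integrable_on {c..d}" if "a \<le> c" for c d
    using integrable_on_subinterval[OF weighted_rate_integrable[of c], of c d] that assms by (simp add: subset_iff)
  have "?P a b"
    using assms(2)
  proof (induction rule: Bolzano[where P = ?P])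
    case (trans c d e)
    show ?case
    proof
      assume c: "a \<le> c"
      have "integral {c..d} (\<lambda>s. w s * weight s) + integral {d..e} (\<lambda>s. w s * weight s)
          = integral {c..e} (\<lambda>s. w s * weight s)"
        using trans int[OF c] by (intro Henstock_Kurzweil_Integration.integral_combine) auto
      then show "2 * integral {c..e} (\<lambda>s. w s * weight s) \<le> weight c - weight e"
        using trans c by linarith
    qed
  next
    case (local x)
    note x = local
    have "isCont weight x"
      using weight_continuous assms x by (simp add: continuous_on_eq_continuous_at)
    moreover have "weight x / 3 > 0" using weight_pos[of x] by simp
    ultimately obtain \<delta> where \<delta>: "\<delta> > 0" "\<And>y. dist y x < \<delta> \<Longrightarrow> dist (weight y) (weight x) < weight x / 3"
      unfolding continuous_at_eps_delta by (metis dist_commute)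
    have "2 * integral {c..d} (\<lambda>s. w s * weight s) \<le> weight c - weight d"
      if cd: "c \<le> x" "x \<le> d" "d - c < \<delta>" "a \<le> c" for c d
    proof -
      have c: "0 < c" "c \<le> d" using cd assms by auto
      have "integral {c..d} (\<lambda>s. w s * weight s) \<le> integral {c..d} (\<lambda>s. w s * weight c)"
        using c rate_nonneg int[OF cd(4)] integrable_on_mult_left[OF rate_integrable_interval[OF c(1)]]
        by (intro integral_le mult_left_mono weight_antimono) auto
      also have "\<dots> = weight c * (tail_mass c - tail_mass d)"
        using tail_mass_split[OF c] by simp
      also have "\<dots> \<le> 2 * weight d * (tail_mass c - tail_mass d)"
      proof (intro mult_right_mono)
        have "\<bar>weight c - weight x\<bar> < weight x / 3" "\<bar>weight d - weight x\<bar> < weight x / 3"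
          using \<delta>(2)[of c] \<delta>(2)[of d] cd by (auto simp: dist_real_def)
        then show "weight c \<le> 2 * weight d" by linarith
      qed (use tail_mass_antimono[OF c] in simp)
      also have "\<dots> \<le> (weight c - weight d) / 2"
      proof -
        have "1 + 4 * (tail_mass c - tail_mass d) \<le> exp (4 * (tail_mass c - tail_mass d))" by (rule exp_ge_add_one_self)
        then have "weight d * (1 + 4 * (tail_mass c - tail_mass d)) \<le> weight d * exp (4 * (tail_mass c - tail_mass d))"
          using weight_pos[of d] by (intro mult_left_mono) auto
        also have "\<dots> = weight c"
          unfolding weight_def by (simp flip: exp_add)
        finally show ?thesis by (simp add: algebra_simps)
      qed
      finally show ?thesis by simp
    qed
    then show ?case using \<delta>(1) by blast
  qed
  then show ?thesis by simp
qed

lemma weighted_rate_tail_bound: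
  assumes "0 < t"
  shows "integral {t..} (\<lambda>s. w s * weight s) \<le> (weight t - 1) / 2"
proof -
  have lim: "((\<lambda>b. integral {t..b} (\<lambda>s. w s * weight s)) \<longlongrightarrow> integral {t..} (\<lambda>s. w s * weight s)) at_top"
    by (rule tendsto_integral_at_top)
      (use weighted_rate_integrable[OF assms] assms rate_nonneg weight_pos in \<open>auto simp: less_imp_le\<close>)
  have "eventually (\<lambda>b. integral {t..b} (\<lambda>s. w s * weight s) \<le> (weight t - 1) / 2) at_top"
    using eventually_ge_at_top[of t]
  proof eventually_elim
    case (elim b)
    then show ?case using weighted_rate_interval_bound[OF assms elim] weight_ge_1[of b] assms by simp
  qed
  then show ?thesis
    by (rule tendsto_upperbound[OF lim]) simp
qed

end

section \<open>Flows of linear autonomous systems\<close>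

lemma vector_derivative_continuous_on:
  assumes "\<And>t. t \<in> S \<Longrightarrow> (x has_vector_derivative x' t) (at t)"
  shows "continuous_on S x"
  by (rule continuous_at_imp_continuous_on, rule ballI)
    (rule has_vector_derivative_continuous[OF assms])

text \<open>The function \<open>\<parallel>x(t)\<parallel>\<^sup>2 e^(-2\<parallel>A\<parallel>t)\<close> is nonincreasing.\<close>

lemma linear_ode_zero_forward:
  fixes A :: "'a::real_inner \<Rightarrow>\<^sub>L 'a"
  assumes x: "\<And>t. (x has_vector_derivative A (x t)) (at t)" and 0: "x 0 = 0" and t: "t \<ge> 0"
  shows "x t = 0"
proof -
  define u where "u s = (x s \<bullet> x s) * exp (- 2 * norm A * s)" for s
  have "u t \<le> u 0"
  proof (rule DERIV_nonpos_imp_nonincreasing[OF t])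
    fix s
    have "((\<lambda>s. x s \<bullet> x s) has_real_derivative (x s \<bullet> A (x s) + A (x s) \<bullet> x s)) (at s)"
      unfolding has_real_derivative_iff_has_vector_derivative
      by (rule bounded_bilinear.has_vector_derivative[OF bounded_bilinear_inner x x])
    then have "(u has_real_derivative ((x s \<bullet> A (x s) + A (x s) \<bullet> x s) * exp (- 2 * norm A * s)
        + (- 2 * norm A * exp (- 2 * norm A * s)) * (x s \<bullet> x s))) (at s)"
      unfolding u_def by (auto intro!: derivative_eq_intros)
    moreover have "(x s \<bullet> A (x s) + A (x s) \<bullet> x s) * exp (- 2 * norm A * s)
        + (- 2 * norm A * exp (- 2 * norm A * s)) * (x s \<bullet> x s) \<le> 0"
    proof -
      have "x s \<bullet> A (x s) \<le> norm (x s) * norm (A (x s))" by (rule norm_cauchy_schwarz)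
      also have "\<dots> \<le> norm (x s) * (norm A * norm (x s))"
        by (intro mult_left_mono norm_blinfun) auto
      also have "\<dots> = norm A * (x s \<bullet> x s)"
        by (simp add: power2_norm_eq_inner[symmetric] power2_eq_square)
      finally have "(2 * (x s \<bullet> A (x s)) - 2 * norm A * (x s \<bullet> x s)) * exp (- 2 * norm A * s) \<le> 0"
        by (intro mult_nonpos_nonneg) auto
      then show ?thesis by (simp add: inner_commute[of "A (x s)"] algebra_simps)
    qed
    ultimately show "\<exists>y. (u has_real_derivative y) (at s) \<and> y \<le> 0" by blast
  qed
  then have "x t \<bullet> x t \<le> 0"
    using 0 by (simp add: u_def mult_le_0_iff zero_less_mult_iff)
  then show ?thesis by (metis antisym inner_eq_zero_iff inner_ge_zero)
qed

lemma linear_ode_zero: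
  fixes A :: "'a::real_inner \<Rightarrow>\<^sub>L 'a"
  assumes x: "\<And>t. (x has_vector_derivative A (x t)) (at t)" and 0: "x 0 = 0"
  shows "x t = 0"
proof (cases "t \<ge> 0")
  case True
  then show ?thesis using linear_ode_zero_forward[OF x 0] by blast
next
  case False
  have "((\<lambda>s. x (- s)) has_vector_derivative (- A) (x (- s))) (at s)" for s
  proof -
    have "((x \<circ> uminus) has_vector_derivative (- 1) *\<^sub>R A (x (- s))) (at s)"
      by (rule vector_diff_chain_at[OF _ x]) (auto intro!: derivative_eq_intros)
    then show ?thesis by (simp add: o_def blinfun.minus_left)
  qed
  then show ?thesis
    using linear_ode_zero_forward[of "\<lambda>s. x (- s)" "- A" "- t"] False 0 by simp
qed

locale linear_flow =
  fixes A :: "'a::euclidean_space \<Rightarrow>\<^sub>L 'a" and X :: "real \<Rightarrow> 'a \<Rightarrow>\<^sub>L 'a"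
  assumes X_deriv: "\<And>t. (X has_vector_derivative (A o\<^sub>L X t)) (at t)"
    and X_0: "X 0 = id_blinfun"
begin

lemma X_apply_deriv: "((\<lambda>t. X t v) has_vector_derivative A (X t v)) (at t within S)"
  using bounded_linear.has_vector_derivative[OF blinfun.bounded_linear_left X_deriv[of t], of v]
  by (simp add: has_vector_derivative_at_within)

lemma X_continuous: "continuous_on S X"
  by (rule vector_derivative_continuous_on, rule X_deriv)

lemma X_apply_continuous: "continuous_on S (\<lambda>t. X t v)"
  by (intro blinfun.continuous_on X_continuous continuous_on_const)

lemma solution_eq_flow:
  assumes "\<And>t. (x has_vector_derivative A (x t)) (at t)"
  shows "x t = X t (x 0)"
proof -
  have "x t - X t (x 0) = 0"
  proof (rule linear_ode_zero[where x = "\<lambda>t. x t - X t (x 0)" and A = A])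
    fix t
    have "((\<lambda>t. x t - X t (x 0)) has_vector_derivative A (x t) - A (X t (x 0))) (at t)"
      by (intro has_vector_derivative_diff assms X_apply_deriv)
    then show "((\<lambda>t. x t - X t (x 0)) has_vector_derivative A (x t - X t (x 0))) (at t)"
      by (simp add: blinfun.diff_right)
  qed (simp add: X_0)
  then show ?thesis by simp
qed

text \<open>As functions of \<open>s\<close>, both sides solve the system with the same value at \<open>s = 0\<close>.\<close>

lemma X_add: "X (s + t) v = X s (X t v)"
proof -
  have "((\<lambda>s. X (s + t) v) has_vector_derivative A (X (s + t) v)) (at s)" for s
  proof -
    have "((\<lambda>t. X t v) \<circ> (\<lambda>s. s + t) has_vector_derivative 1 *\<^sub>R A (X (s + t) v)) (at s)"
      by (rule vector_diff_chain_at[OF _ X_apply_deriv]) (auto intro!: derivative_eq_intros)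
    then show ?thesis by (simp add: o_def)
  qed
  from solution_eq_flow[OF this, of s] show ?thesis by simp
qed

lemma X_minus_cancel [simp]: "X (- t) (X t v) = v" "X t (X (- t) v) = v"
  using X_add[of "-t" t v] X_add[of t "-t" v] by (simp_all add: X_0)

definition bounded_orbits :: "'a set" where "bounded_orbits = {v. \<exists>K. \<forall>t. norm (X t v) \<le> K}"

lemma subspace_bounded_orbits: "Real_Vector_Spaces.subspace bounded_orbits"
  unfolding real_vector.subspace_def bounded_orbits_def
proof (safe)
  show "\<exists>K. \<forall>t. norm (X t 0) \<le> K" by (auto simp: blinfun.zero_right)
  fix v w K L
  assume "\<forall>t. norm (X t v) \<le> K" "\<forall>t. norm (X t w) \<le> L"
  then show "\<exists>K. \<forall>t. norm (X t (v + w)) \<le> K"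
    by (intro exI[of _ "K + L"]) (auto simp: blinfun.add_right intro: norm_triangle_mono)
next
  fix c :: real and v K
  assume "\<forall>t. norm (X t v) \<le> K"
  then show "\<exists>K. \<forall>t. norm (X t (c *\<^sub>R v)) \<le> K"
    by (intro exI[of _ "\<bar>c\<bar> * K"]) (auto simp: blinfun.scaleR_right mult_left_mono)
qed

lemma X_bounded_orbits: "v \<in> bounded_orbits \<Longrightarrow> X t v \<in> bounded_orbits"
  unfolding bounded_orbits_def by (auto simp: X_add[symmetric])

text \<open>Each vector of a finite basis of the subspace has a bounded orbit, and orbits depend linearly on
  the vector.\<close>

lemma uniform_bound_bounded_orbits:
  obtains M where "M \<ge> 1" "\<And>t v. v \<in> bounded_orbits \<Longrightarrow> norm (X t v) \<le> M * norm v"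
proof -
  obtain E where E: "E \<subseteq> bounded_orbits" "pairwise Linear_Algebra.orthogonal E" "\<And>x. x \<in> E \<Longrightarrow> norm x = 1"
      "independent E" "span E = bounded_orbits"
    using orthonormal_basis_subspace[OF subspace_bounded_orbits] by metis
  have fin: "finite E" using E(4) by (rule independent_imp_finite)
  obtain K where K: "\<And>e t. e \<in> E \<Longrightarrow> norm (X t e) \<le> K e"
    using E(1) unfolding bounded_orbits_def by (auto simp: subset_iff) metis
  have K0: "0 \<le> K e" if "e \<in> E" for e
    using K[OF that, of 0] norm_ge_zero order_trans by blast
  show ?thesis
  proof
    show "1 + sum K E \<ge> 1" using K0 by (simp add: sum_nonneg)
    fix t v assume v: "v \<in> bounded_orbits"
    have "v = (\<Sum>e\<in>E. (v \<bullet> e) *\<^sub>R e)"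
      by (rule sym, rule orthonormal_basis_expand) (use E v fin in auto)
    then have "X t v = (\<Sum>e\<in>E. (v \<bullet> e) *\<^sub>R X t e)"
      by (metis (no_types, lifting) blinfun.scaleR_right blinfun.sum_right sum.cong)
    also have "norm \<dots> \<le> (\<Sum>e\<in>E. norm v * K e)"
    proof (rule sum_norm_le)
      fix e assume e: "e \<in> E"
      have "\<bar>v \<bullet> e\<bar> \<le> norm v" using Cauchy_Schwarz_ineq2[of v e] E(3)[OF e] by simp
      then show "norm ((v \<bullet> e) *\<^sub>R X t e) \<le> norm v * K e"
        using K[OF e, of t] by (auto intro!: mult_mono)
    qed
    also have "\<dots> \<le> (1 + sum K E) * norm v"
      unfolding sum_distrib_left[symmetric] by (simp add: algebra_simps)
    finally show "norm (X t v) \<le> (1 + sum K E) * norm v" .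
  qed
qed

end

lemma (in linear_flow) flow_homeomorphic_initial_values:
  assumes "S \<subseteq> bounded_orbits"
  shows "top_of_set S homeomorphic_space subtopology (compact_open_topology UNIV) ((\<lambda>a t. X t a) ` S)"
proof -
  obtain M where M: "M \<ge> 1" "\<And>t v. v \<in> bounded_orbits \<Longrightarrow> norm (X t v) \<le> M * norm v"
    using uniform_bound_bounded_orbits by blast
  show ?thesis
  proof (rule homeomorphic_image_compact_open[where T = 0 and L = 1])
    show "(\<lambda>t. X t a) \<in> continuous_functions UNIV" for a
      by (simp add: continuous_functions_def X_apply_continuous)
    fix a K and \<epsilon> :: real assume a: "a \<in> S" and \<epsilon>: "\<epsilon> > 0"
    have "dist (X t a) (X t b) < \<epsilon>" if b: "b \<in> S" "dist a b < \<epsilon> / M" for b t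
    proof -
      have "dist (X t a) (X t b) \<le> M * norm (a - b)"
        using M(2)[of "a - b" t] a b(1) assms real_vector.subspace_diff[OF subspace_bounded_orbits, of a b]
        by (auto simp: dist_norm blinfun.diff_right)
      also have "\<dots> < \<epsilon>" using b(2) M(1) by (simp add: dist_norm field_simps)
      finally show ?thesis .
    qed
    then show "\<exists>\<delta>>0. \<forall>b\<in>S. dist a b < \<delta> \<longrightarrow> (\<forall>t\<in>K. dist (X t a) (X t b) < \<epsilon>)"
      using \<epsilon> M(1) by (intro exI[of _ "\<epsilon> / M"]) auto
  qed (auto simp: X_0)
qed

section \<open>The integral equation on the open half-line\<close>

text \<open>The instance of \<open>kernel\<close> with \<open>t = 0\<close> makes \<open>X (- s) (f (s, y s))\<close> integrable up to infinity, so that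
  \<open>X t\<close> can be pulled out of the integral of \<open>X (t - s) (f (s, y s))\<close>; the instances with \<open>t > 0\<close> give the
  sharp estimate of that integral.\<close>

locale perturbed_flow = linear_flow A X + integrable_tail w
  for A :: "'a::euclidean_space \<Rightarrow>\<^sub>L 'a" and X w +
  fixes f :: "real \<times> 'a \<Rightarrow> 'a"
  assumes f_cont: "continuous_on UNIV f"
    and f_zero: "\<And>t. f (t, 0) = 0"
    and kernel: "\<And>t s y z. 0 \<le> t \<Longrightarrow> t \<le> s \<Longrightarrow> 0 < s \<Longrightarrow>
      norm (X (t - s) (f (s, y) - f (s, z))) \<le> w s * norm (y - z)"
begin

definition admissible :: "(real \<Rightarrow> 'a) \<Rightarrow> bool" where
  "admissible y \<longleftrightarrow> continuous_on {0<..} y \<and> (\<exists>c. \<forall>s>0. norm (y s) \<le> c * weight s)"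

text \<open>The integral \<open>\<integral>\<^sub>t\<^sup>\<infinity> X(t-s) f(s,y(s)) ds\<close>, by which the perturbed solution differs from the linear
  one. The factor \<open>X t\<close> is kept outside, which makes differentiability in \<open>t\<close> evident.\<close>

definition correction :: "(real \<Rightarrow> 'a) \<Rightarrow> real \<Rightarrow> 'a" where
  "correction y t = X t (integral {t..} (\<lambda>s. X (- s) (f (s, y s))))"

lemma f_comp_continuous:
  "continuous_on S y \<Longrightarrow> continuous_on S (\<lambda>s. f (s, y s))"
  by (rule continuous_on_compose2[OF f_cont]) (auto intro!: continuous_intros)

lemma integrand_continuous:
  assumes "continuous_on S y"
  shows "continuous_on S (\<lambda>s. X (c - s) (f (s, y s)))"
  by (intro blinfun.continuous_on f_comp_continuous[OF assms]
      continuous_on_compose2[OF X_continuous[of UNIV]] continuous_intros) auto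

lemma integrand_integrable:
  assumes y: "admissible y" and t: "0 < t" "0 \<le> \<tau>" "\<tau> \<le> t"
  shows "(\<lambda>s. X (\<tau> - s) (f (s, y s))) integrable_on {t..}"
proof -
  obtain c where c: "\<And>s. s > 0 \<Longrightarrow> norm (y s) \<le> c * weight s" and yc: "continuous_on {0<..} y"
    using y unfolding admissible_def by blast
  show ?thesis
  proof (rule measurable_bounded_by_integrable_imp_integrable)
    show "(\<lambda>s. X (\<tau> - s) (f (s, y s))) \<in> borel_measurable (lebesgue_on {t..})"
      using t by (intro continuous_imp_measurable_on_sets_lebesgue integrand_continuous
          continuous_on_subset[OF yc]) auto
    show "(\<lambda>s. c * (w s * weight s)) integrable_on {t..}"
      using integrable_on_mult_right[OF weighted_rate_integrable[OF t(1)]] by simp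
    fix s assume s: "s \<in> {t..}"
    have "norm (X (\<tau> - s) (f (s, y s))) \<le> w s * norm (y s)"
      using kernel[of \<tau> s "y s" 0] s t by (simp add: f_zero)
    also have "\<dots> \<le> w s * (c * weight s)"
      using s t c rate_nonneg by (intro mult_left_mono) auto
    finally show "norm (X (\<tau> - s) (f (s, y s))) \<le> c * (w s * weight s)"
      by (simp add: algebra_simps)
  qed auto
qed

lemma correction_eq:
  assumes "admissible y" "0 < t"
  shows "correction y t = integral {t..} (\<lambda>s. X (t - s) (f (s, y s)))"
proof -
  have "integral {t..} (X t \<circ> (\<lambda>s. X (- s) (f (s, y s))))
      = X t (integral {t..} (\<lambda>s. X (- s) (f (s, y s))))"
    using integrand_integrable[of y t 0] assms
    by (intro integral_linear blinfun.bounded_linear_right) auto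
  then show ?thesis
    by (simp add: correction_def o_def X_add[symmetric])
qed

lemma correction_diff_bound:
  assumes y: "admissible y" and z: "admissible z" and c: "\<And>s. s > 0 \<Longrightarrow> norm (y s - z s) \<le> c * weight s"
    and t: "0 < t"
  shows "norm (correction y t - correction z t) \<le> c * ((weight t - 1) / 2)"
proof -
  have int: "(\<lambda>s. X (t - s) (f (s, y s)) - X (t - s) (f (s, z s))) integrable_on {t..}"
    using t by (intro integrable_diff integrand_integrable y z) auto
  have c0: "c \<ge> 0"
    using c[OF t] weight_pos[of t] norm_ge_zero order_trans by (metis zero_le_mult_iff not_less)
  have "correction y t - correction z t = integral {t..} (\<lambda>s. X (t - s) (f (s, y s)) - X (t - s) (f (s, z s)))"
    unfolding correction_eq[OF y t] correction_eq[OF z t] using t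
    by (intro integral_diff[symmetric] integrand_integrable y z) auto
  also have "norm \<dots> \<le> integral {t..} (\<lambda>s. c * (w s * weight s))"
  proof (rule integral_norm_bound_integral[OF int])
    show "(\<lambda>s. c * (w s * weight s)) integrable_on {t..}"
      using integrable_on_mult_right[OF weighted_rate_integrable[OF t]] by simp
    fix s assume s: "s \<in> {t..}"
    have "norm (X (t - s) (f (s, y s)) - X (t - s) (f (s, z s))) \<le> w s * norm (y s - z s)"
      using kernel[of t s "y s" "z s"] s t by (simp add: blinfun.diff_right)
    also have "\<dots> \<le> w s * (c * weight s)"
      using s t c rate_nonneg by (intro mult_left_mono) auto
    finally show "norm (X (t - s) (f (s, y s)) - X (t - s) (f (s, z s))) \<le> c * (w s * weight s)"
      by (simp add: algebra_simps)
  qed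
  also have "\<dots> = c * integral {t..} (\<lambda>s. w s * weight s)" by simp
  also have "\<dots> \<le> c * ((weight t - 1) / 2)"
    by (intro mult_left_mono weighted_rate_tail_bound t c0)
  finally show ?thesis .
qed

lemma correction_zero: "correction (\<lambda>_. 0) t = 0"
  by (simp add: correction_def f_zero blinfun.zero_right)

lemma admissible_zero: "admissible (\<lambda>_. 0)"
  unfolding admissible_def by (auto intro!: exI[of _ 0])

lemma correction_bound:
  assumes y: "admissible y" and c: "\<And>s. s > 0 \<Longrightarrow> norm (y s) \<le> c * weight s" and t: "0 < t"
  shows "norm (correction y t) \<le> c * ((weight t - 1) / 2)"
  using correction_diff_bound[OF y admissible_zero _ t, of c] c by (simp add: correction_zero)

lemma correction_deriv:
  assumes y: "admissible y" and t: "0 < t"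
  shows "(correction y has_vector_derivative A (correction y t) - f (t, y t)) (at t)"
proof -
  let ?h = "\<lambda>s. X (- s) (f (s, y s))"
  define G where "G t = integral {t..} ?h" for t
  have yc: "continuous_on {0<..} y" using y by (simp add: admissible_def)
  have hc: "continuous_on {t/2..t+1} ?h"
  proof -
    have "continuous_on {t/2..t+1} y" using t by (intro continuous_on_subset[OF yc]) auto
    from integrand_continuous[OF this, of 0] show ?thesis by (simp del: continuous_on_minus)
  qed
  have int: "?h integrable_on {s..}" if "0 < s" for s
    using integrand_integrable[OF y that, of 0] that by simp
  have G: "G s = G (t/2) - integral {t/2..s} ?h" if s: "s \<in> {t/2..t+1}" for s
  proof -
    have eq: "{t/2..s} \<union> {s..} = {t/2..}" using s by auto
    have "negligible ({t/2..s} \<inter> {s..})"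
      by (rule negligible_subset[of "{s}"]) (use s in auto)
    moreover have "?h integrable_on {t/2..s}"
      using s by (intro integrable_continuous_interval continuous_on_subset[OF hc]) auto
    ultimately have "(?h has_integral (integral {t/2..s} ?h + integral {s..} ?h)) ({t/2..s} \<union> {s..})"
      using s t by (intro has_integral_Un integrable_integral int) auto
    then show ?thesis
      unfolding G_def eq by (simp add: integral_unique)
  qed
  have "((\<lambda>s. G (t/2) - integral {t/2..s} ?h) has_vector_derivative 0 - ?h t) (at t within {t/2..t+1})"
    using t by (intro has_vector_derivative_diff has_vector_derivative_const
        integral_has_vector_derivative hc) auto
  from has_vector_derivative_transform[OF _ G this]
  have "(G has_vector_derivative - ?h t) (at t within {t/2..t+1})"
    using t by simp
  then have "(G has_vector_derivative - ?h t) (at t)"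
    using t by (subst (asm) at_within_interior) auto
  then have "((\<lambda>s. X s (G s)) has_vector_derivative X t (- ?h t) + (A o\<^sub>L X t) (G t)) (at t)"
    by (rule bounded_bilinear.has_vector_derivative[OF bounded_bilinear_blinfun_apply X_deriv])
  then show ?thesis
    unfolding correction_def[abs_def] G_def by (simp add: blinfun.minus_right)
qed

lemma correction_continuous: "admissible y \<Longrightarrow> continuous_on {0<..} (correction y)"
  by (rule vector_derivative_continuous_on, rule correction_deriv) auto

text \<open>Banach's theorem is applied to bounded continuous functions \<open>g\<close> on the whole line. The
  substitution \<open>y(t) = weight(t) g(ln t)\<close> identifies them with the continuous functions on
  \<open>(0,\<infinity>)\<close> that are bounded by a multiple of the weight.\<close>

lemma exists_fixed_point:
  assumes a: "a \<in> bounded_orbits"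
  shows "\<exists>y. admissible y \<and> (\<forall>t>0. y t = X t a - correction y t)"
proof -
  obtain K where K: "\<And>t. norm (X t a) \<le> K"
    using a unfolding bounded_orbits_def by blast
  have K0: "K \<ge> 0" using K[of 0] norm_ge_zero order_trans by blast
  define Y where "Y g s = weight s *\<^sub>R apply_bcontfun g (ln s)" for g :: "real \<Rightarrow>\<^sub>C 'a" and s
  have Y_bound: "norm (Y g s - Y h s) \<le> dist g h * weight s" for g h s
  proof -
    have "norm (Y g s - Y h s) = weight s * dist (apply_bcontfun g (ln s)) (apply_bcontfun h (ln s))"
      using weight_pos[of s] by (simp add: Y_def dist_norm flip: scaleR_diff_right)
    also have "\<dots> \<le> weight s * dist g h"
      using weight_pos[of s] by (intro mult_left_mono dist_bounded) auto
    finally show ?thesis by (simp add: mult.commute)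
  qed
  have Y0: "Y 0 s = 0" for s by (simp add: Y_def)
  have Y_norm: "norm (Y g s) \<le> norm g * weight s" for g s
    using Y_bound[of g s 0] by (simp add: Y0)
  have Y_adm: "admissible (Y g)" for g
    unfolding admissible_def
  proof (intro conjI exI allI impI)
    have "continuous_on {0<..} (\<lambda>s. apply_bcontfun g (ln s))"
      by (rule continuous_on_compose2[OF continuous_on_apply_bcontfun[of UNIV]])
        (auto intro!: continuous_intros)
    then show "continuous_on {0<..} (Y g)"
      unfolding Y_def by (intro continuous_intros weight_continuous)
  qed (rule Y_norm)
  \<comment> \<open>The integral operator in terms of \<open>g\<close>, at the time \<open>exp r\<close>.\<close>
  define \<psi> where "\<psi> g r = (1 / weight (exp r)) *\<^sub>R (X (exp r) a - correction (Y g) (exp r))" for g r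
  have \<psi>: "\<psi> g \<in> bcontfun" for g
    unfolding bcontfun_def mem_Collect_eq
  proof
    have "continuous_on UNIV (\<lambda>r. correction (Y g) (exp r))"
      by (rule continuous_on_compose2[OF correction_continuous[OF Y_adm]]) (auto intro!: continuous_intros)
    moreover have "continuous_on UNIV (\<lambda>r. weight (exp r))"
      by (rule continuous_on_compose2[OF weight_continuous]) (auto intro!: continuous_intros)
    moreover have "continuous_on UNIV (\<lambda>r. X (exp r) a)"
      by (rule continuous_on_compose2[OF X_apply_continuous[of UNIV]]) (auto intro!: continuous_intros)
    ultimately show "continuous_on UNIV (\<psi> g)"
      unfolding \<psi>_def using weight_pos
      by (intro continuous_on_scaleR continuous_on_divide continuous_on_const continuous_on_diff)
        (auto simp: less_imp_neq[symmetric])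
    have "norm (\<psi> g r) \<le> K + norm g" for r
    proof -
      let ?t = "exp r :: real"
      have p1: "weight ?t \<ge> 1" by (intro weight_ge_1) simp
      have "norm (X ?t a - correction (Y g) ?t) \<le> K + norm g * ((weight ?t - 1) / 2)"
        by (intro order_trans[OF norm_triangle_ineq4] add_mono K correction_bound[OF Y_adm Y_norm]) simp
      also have "\<dots> \<le> K * weight ?t + norm g * weight ?t"
        using p1 K0 by (intro add_mono mult_left_mono) (auto simp: mult_le_cancel_left1 le_less_trans)
      finally show ?thesis
        unfolding \<psi>_def norm_scaleR using weight_pos[of ?t] by (simp add: divide_le_eq algebra_simps)
    qed
    then show "bounded (range (\<psi> g))"
      by (intro boundedI[of _ "K + norm g"]) auto
  qed
  have "\<exists>!g. Bcontfun (\<psi> g) = g"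
  proof (rule banach_fix_type[of "1/2"]; (intro allI)?)
    fix g h
    show "dist (Bcontfun (\<psi> g)) (Bcontfun (\<psi> h)) \<le> 1/2 * dist g h"
    proof (rule dist_bound)
      fix r
      let ?t = "exp r :: real"
      have "dist (apply_bcontfun (Bcontfun (\<psi> g)) r) (apply_bcontfun (Bcontfun (\<psi> h)) r)
          = norm (\<psi> g r - \<psi> h r)"
        by (simp add: Bcontfun_inverse \<psi> dist_norm)
      also have "\<psi> g r - \<psi> h r = (1 / weight ?t) *\<^sub>R (correction (Y h) ?t - correction (Y g) ?t)"
        unfolding \<psi>_def by (simp flip: scaleR_diff_right)
      also have "norm \<dots> = norm (correction (Y h) ?t - correction (Y g) ?t) / weight ?t"
        using weight_pos[of ?t] by simp
      also have "\<dots> \<le> dist h g * ((weight ?t - 1) / 2) / weight ?t"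
        using weight_pos[of ?t]
        by (intro divide_right_mono correction_diff_bound[OF Y_adm Y_adm Y_bound]) auto
      also have "\<dots> \<le> dist h g * (weight ?t / 2) / weight ?t"
        using weight_pos[of ?t] by (intro divide_right_mono mult_left_mono) auto
      also have "\<dots> = 1/2 * dist g h"
        using weight_pos[of ?t] by (simp add: dist_commute)
      finally show "dist (apply_bcontfun (Bcontfun (\<psi> g)) r) (apply_bcontfun (Bcontfun (\<psi> h)) r)
        \<le> 1/2 * dist g h" .
    qed
  qed auto
  then obtain g where g: "Bcontfun (\<psi> g) = g" by blast
  have "Y g t = X t a - correction (Y g) t" if t: "t > 0" for t
  proof -
    have "apply_bcontfun g (ln t) = \<psi> g (ln t)"
      using Bcontfun_inverse[OF \<psi>, of g] g by simp
    then show ?thesis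
      using t weight_pos[of t] by (simp add: Y_def \<psi>_def)
  qed
  then show ?thesis using Y_adm by blast
qed

definition sol :: "'a \<Rightarrow> real \<Rightarrow> 'a" where
  "sol a = (SOME y. admissible y \<and> (\<forall>t>0. y t = X t a - correction y t))"

lemma sol:
  assumes "a \<in> bounded_orbits"
  shows "admissible (sol a)" "t > 0 \<Longrightarrow> sol a t = X t a - correction (sol a) t"
  using someI_ex[OF exists_fixed_point[OF assms]] by (auto simp: sol_def)

lemma sol_deriv:
  assumes a: "a \<in> bounded_orbits" and t: "t > 0"
  shows "(sol a has_vector_derivative A (sol a t) + f (t, sol a t)) (at t)"
proof -
  have "((\<lambda>t. X t a - correction (sol a) t) has_vector_derivative
      A (X t a) - (A (correction (sol a) t) - f (t, sol a t))) (at t)"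
    by (intro has_vector_derivative_diff X_apply_deriv correction_deriv sol a t)
  also have "A (X t a) - (A (correction (sol a) t) - f (t, sol a t)) = A (sol a t) + f (t, sol a t)"
    unfolding sol(2)[OF a t] by (simp add: blinfun.diff_right)
  finally show ?thesis
    by (rule has_vector_derivative_transform_within_open[of _ _ _ "{0<..}"]) (use sol(2)[OF a] t in auto)
qed

text \<open>The supremum \<open>Q\<close> of \<open>\<parallel>y - z\<parallel> / weight\<close> is finite and satisfies \<open>Q \<le> D + Q/2\<close>.\<close>

lemma fixed_point_diff_bound:
  assumes y: "admissible y" "\<And>t. t > 0 \<Longrightarrow> y t = X t a - correction y t"
    and z: "admissible z" "\<And>t. t > 0 \<Longrightarrow> z t = X t b - correction z t"
    and D: "\<And>t. norm (X t (a - b)) \<le> D" and t: "t > 0"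
  shows "norm (y t - z t) \<le> 2 * D * weight t"
proof -
  define q where "q s = norm (y s - z s) / weight s" for s
  obtain c c' where c: "\<And>s. s > 0 \<Longrightarrow> norm (y s) \<le> c * weight s" "\<And>s. s > 0 \<Longrightarrow> norm (z s) \<le> c' * weight s"
    using y(1) z(1) unfolding admissible_def by blast
  have "q s \<le> c + c'" if "s > 0" for s
  proof -
    have "norm (y s - z s) \<le> c * weight s + c' * weight s"
      using norm_triangle_ineq4[of "y s" "z s"] c[OF that] by linarith
    then show ?thesis
      using weight_pos[of s] by (simp add: q_def divide_le_eq algebra_simps)
  qed
  then have bdd: "bdd_above (q ` {0<..})" by (intro bdd_aboveI2[of _ _ "c + c'"]) auto
  define Q where "Q = (SUP s\<in>{0<..}. q s)"
  have qQ: "norm (y s - z s) \<le> Q * weight s" if "s > 0" for s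
    using cSUP_upper[OF _ bdd, of s] that weight_pos[of s] by (simp add: q_def Q_def divide_le_eq)
  have Q0: "Q \<ge> 0"
    using cSUP_upper2[OF bdd, of 1 0] weight_pos[of 1] by (simp add: Q_def q_def)
  have D0: "D \<ge> 0" using D[of 0] norm_ge_zero order_trans by blast
  have "q s \<le> D + Q / 2" if s: "s > 0" for s
  proof -
    have "y s - z s = X s (a - b) - (correction y s - correction z s)"
      unfolding y(2)[OF s] z(2)[OF s] by (simp add: blinfun.diff_right)
    also have "norm \<dots> \<le> D + Q * ((weight s - 1) / 2)"
      by (intro order_trans[OF norm_triangle_ineq4] add_mono D correction_diff_bound y z qQ s)
    also have "\<dots> \<le> D * weight s + Q * (weight s / 2)"
      using weight_ge_1[OF s] D0 Q0 by (intro add_mono mult_left_mono) (auto simp: mult_le_cancel_left1)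
    finally show ?thesis
      using weight_pos[of s] by (simp add: q_def divide_le_eq algebra_simps)
  qed
  then have "Q \<le> D + Q / 2"
    unfolding Q_def by (intro cSUP_least) auto
  then have "Q * weight t \<le> 2 * D * weight t" using weight_pos[of t] by (intro mult_right_mono) auto
  then show ?thesis using qQ[OF t] by linarith
qed

lemma sol_diff_bound:
  assumes a: "a \<in> bounded_orbits" and b: "b \<in> bounded_orbits" and D: "\<And>t. norm (X t (a - b)) \<le> D" and t: "t > 0"
  shows "norm (sol a t - sol b t) \<le> 2 * D * weight t"
  by (rule fixed_point_diff_bound[OF sol(1)[OF a] sol(2)[OF a] sol(1)[OF b] sol(2)[OF b] D t])

text \<open>This is the estimate that makes \<open>a \<mapsto> sol a\<close> invertible: at late times \<open>weight\<close> is close to \<open>1\<close>, so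
  that \<open>sol a - sol b\<close> is a small perturbation of the linear solution \<open>X t (a - b)\<close>.\<close>

lemma sol_diff_flow_bound:
  assumes a: "a \<in> bounded_orbits" and b: "b \<in> bounded_orbits" and D: "\<And>t. norm (X t (a - b)) \<le> D" and t: "t > 0"
  shows "norm (sol a t - sol b t - X t (a - b)) \<le> D * (weight t - 1)"
proof -
  have "sol a t - sol b t - X t (a - b) = - (correction (sol a) t - correction (sol b) t)"
    unfolding sol(2)[OF a t] sol(2)[OF b t] by (simp add: blinfun.diff_right)
  also have "norm \<dots> \<le> 2 * D * ((weight t - 1) / 2)"
    unfolding norm_minus_cancel
    by (intro correction_diff_bound sol a b t sol_diff_bound[OF a b D])
  finally show ?thesis by simp
qed

lemma zero_bounded_orbits: "0 \<in> bounded_orbits" using subspace_bounded_orbits by (rule real_vector.subspace_0)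

lemma sol_zero: "t > 0 \<Longrightarrow> sol 0 t = 0"
  using fixed_point_diff_bound[OF sol(1)[OF zero_bounded_orbits] sol(2)[OF zero_bounded_orbits] admissible_zero, of 0 0 t]
  by (simp add: correction_zero blinfun.zero_right)

end

section \<open>Extension of small solutions to time zero\<close>

lemma ode_mean_value:
  fixes y :: "real \<Rightarrow> 'a::real_inner"
  assumes "s \<le> t" "\<And>u. u \<in> {s..t} \<Longrightarrow> (y has_vector_derivative F u (y u)) (at u)"
    and "\<And>u. u \<in> {s<..<t} \<Longrightarrow> norm (F u (y u)) \<le> N"
  shows "norm (y t - y s) \<le> N * (t - s)"
proof (cases "s = t")
  case False
  have "continuous_on {s..t} y"
    by (rule vector_derivative_continuous_on, rule assms(2))
  moreover have "(y has_derivative (\<lambda>h. h *\<^sub>R F u (y u))) (at u)" if "s < u" "u < t" for u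
    using assms(2)[of u] that by (simp add: has_vector_derivative_def)
  ultimately obtain u where u: "u \<in> {s<..<t}" "norm (y t - y s) \<le> norm ((t - s) *\<^sub>R F u (y u))"
    using mvt_general[of s t y "\<lambda>u h. h *\<^sub>R F u (y u)"] assms(1) False by auto
  have "norm ((t - s) *\<^sub>R F u (y u)) \<le> (t - s) * N"
    using assms(1,3) u(1) by (auto intro!: mult_left_mono)
  then show ?thesis using u(2) by (simp add: mult.commute)
qed simp

text \<open>A solution that starts in the ball of radius \<open>1/2\<close> at time \<open>\<delta>\<close> and moves with speed at most \<open>N\<close>
  as long as it stays in the unit ball has no time to leave the unit ball before time \<open>0\<close>.\<close>

lemma ode_trapped_in_ball:
  fixes y :: "real \<Rightarrow> 'a::real_inner"
  assumes sol: "\<And>t. t \<in> {0<..\<delta>} \<Longrightarrow> (y has_vector_derivative F t (y t)) (at t)"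
    and N: "\<And>t x. t \<in> {0..\<delta>} \<Longrightarrow> norm x \<le> 1 \<Longrightarrow> norm (F t x) \<le> N"
    and \<delta>: "\<delta> > 0" "N * \<delta> < 1/2" and y\<delta>: "norm (y \<delta>) \<le> 1/2"
    and t: "t \<in> {0<..\<delta>}"
  shows "norm (y t) < 1"
proof (rule ccontr)
  assume "\<not> norm (y t) < 1"
  \<comment> \<open>The last time \<open>s\<close> at which the solution is outside the open unit ball gives a contradiction.\<close>
  define S where "S = {s \<in> {t..\<delta>}. norm (y s) \<ge> 1}"
  have yc: "continuous_on {t..\<delta>} y"
    by (rule vector_derivative_continuous_on, rule sol) (use t in auto)
  have "compact S"
  proof -
    have "S = {t..\<delta>} \<inter> (\<lambda>s. norm (y s)) -` {1..}" by (auto simp: S_def)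
    also have "closed \<dots>"
      by (intro continuous_closed_preimage continuous_intros yc)
    finally have "closed S" .
    moreover have "bounded S"
      by (rule bounded_subset[of "{t..\<delta>}"]) (auto simp: S_def)
    ultimately show ?thesis by (simp add: compact_eq_bounded_closed)
  qed
  moreover have "t \<in> S" using t \<open>\<not> norm (y t) < 1\<close> by (auto simp: S_def)
  ultimately obtain s where s: "s \<in> S" "\<And>u. u \<in> S \<Longrightarrow> u \<le> s"
    using compact_attains_sup[of S] by blast
  have s': "s \<in> {t..\<delta>}" "norm (y s) \<ge> 1" using s(1) by (auto simp: S_def)
  have N0: "N \<ge> 0" using order_trans[OF norm_ge_zero N[of 0 0]] \<delta>(1) by simp
  have "norm (y \<delta> - y s) \<le> N * (\<delta> - s)"
  proof (rule ode_mean_value)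
    fix u assume u: "u \<in> {s<..<\<delta>}"
    then have "u \<notin> S" using s(2)[of u] by auto
    then have "norm (y u) \<le> 1" using u s' by (auto simp: S_def)
    then show "norm (F u (y u)) \<le> N" using u s' t by (intro N) auto
  qed (use sol s' t in auto)
  also have "\<dots> \<le> N * \<delta>" using N0 s' t by (intro mult_left_mono) auto
  finally have "norm (y \<delta> - y s) < 1/2" using \<delta>(2) by simp
  then show False using s'(2) y\<delta> by norm
qed

text \<open>A trapped solution is Lipschitz on \<open>(0,\<delta>]\<close>, so it has a limit at \<open>0\<close>; the integrated
  equation passes to the limit. The uniform Lipschitz constant \<open>N\<close> is recorded because it gives
  equicontinuity up to time \<open>0\<close> without any Lipschitz condition on \<open>F\<close>.\<close>

lemma ode_extends_to_zero:
  fixes y :: "real \<Rightarrow> 'a::euclidean_space"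
  assumes sol: "\<And>t. t > 0 \<Longrightarrow> (y has_vector_derivative F t (y t)) (at t)"
    and F: "continuous_on UNIV (\<lambda>(t, x). F t x)"
    and N: "\<And>t x. t \<in> {0..\<delta>} \<Longrightarrow> norm x \<le> 1 \<Longrightarrow> norm (F t x) \<le> N"
    and \<delta>: "\<delta> > 0" "N * \<delta> < 1/2" and y\<delta>: "norm (y \<delta>) \<le> 1/2"
  shows "\<exists>z. (\<forall>t>0. z t = y t) \<and> z \<in> extensional {0..} \<and> solves_ode_on {0..} F z \<and> N-lipschitz_on {0..\<delta>} z"
proof -
  have N0: "N \<ge> 0" using order_trans[OF norm_ge_zero N[of 0 0]] \<delta>(1) by simp
  have *: "norm (y t - y s) \<le> N * (t - s)" if "0 < s" "s \<le> t" "t \<le> \<delta>" for s t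
  proof (rule ode_mean_value[where F = F])
    fix u assume "u \<in> {s<..<t}"
    then show "norm (F u (y u)) \<le> N"
      using that ode_trapped_in_ball[of \<delta> y F N u] sol N \<delta> y\<delta> by (intro N) (auto simp: less_imp_le)
  qed (use sol that in auto)
  then have "N-lipschitz_on {0<..\<delta>} y"
  proof (intro lipschitz_onI N0)
    fix s t assume "s \<in> {0<..\<delta>}" "t \<in> {0<..\<delta>}"
    then show "dist (y s) (y t) \<le> N * dist s t"
      using *[of s t] *[of t s]
      by (cases "s \<le> t") (auto simp: dist_norm norm_minus_commute abs_real_def)
  qed
  then obtain g where g: "N-lipschitz_on (closure {0<..\<delta>}) g" "\<And>t. t \<in> {0<..\<delta>} \<Longrightarrow> g t = y t"
    using lipschitz_extend_closure by metis
  have cl: "closure {0<..\<delta>} = {0..\<delta>}"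
    using \<delta>(1) by (simp add: closure_greaterThanAtMost)
  define z where "z t = (if t > 0 then y t else if t = 0 then g 0 else undefined)" for t
  have zg: "z t = g t" if "t \<in> {0..\<delta>}" for t using that g(2) by (auto simp: z_def)
  have lip: "N-lipschitz_on {0..\<delta>} z"
    using g(1) unfolding cl by (rule lipschitz_on_transform) (use zg in auto)
  have Fz: "continuous_on {0..\<delta>} (\<lambda>t. F t (z t))"
  proof -
    have "continuous_on {0..\<delta>} (\<lambda>t. (t, z t))"
      by (intro continuous_intros lipschitz_on_continuous_on[OF lip])
    from continuous_on_compose2[OF F this] show ?thesis by simp
  qed
  have zy: "(z has_vector_derivative F t (z t)) (at t)" if "t > 0" for t
    using has_vector_derivative_transform_within_open[OF sol[OF that], of "{0<..}" z] that
    by (auto simp: z_def)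
  have int: "z t = z 0 + integral {0..t} (\<lambda>t. F t (z t))" if "t \<in> {0..\<delta>}" for t
  proof -
    have "((\<lambda>t. F t (z t)) has_integral (z t - z 0)) {0..t}"
      using that zy lipschitz_on_continuous_on[OF lip]
      by (intro fundamental_theorem_of_calculus_interior) (auto intro: continuous_on_subset)
    then show ?thesis by (simp add: integral_unique)
  qed
  have "((\<lambda>t. z 0 + integral {0..t} (\<lambda>t. F t (z t))) has_vector_derivative 0 + F 0 (z 0)) (at 0 within {0..\<delta>})"
    using \<delta>(1) by (intro has_vector_derivative_add has_vector_derivative_const
        integral_has_vector_derivative[OF Fz]) auto
  from has_vector_derivative_transform[OF _ int this]
  have "(z has_vector_derivative F 0 (z 0)) (at 0 within {0..\<delta>})"
    using \<delta>(1) by simp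
  moreover have "at 0 within {0..\<delta>} = at 0 within {0..}"
    using \<delta>(1) by (intro at_within_nhd[of _ "{..<\<delta>}"]) auto
  ultimately have "solves_ode_on {0..} F z"
    unfolding solves_ode_on_def using zy by (auto simp: has_vector_derivative_at_within order_le_less)
  moreover have "z \<in> extensional {0..}" "\<forall>t>0. z t = y t"
    by (auto simp: z_def extensional_def)
  ultimately show ?thesis using lip by blast
qed

context perturbed_flow
begin

text \<open>The number \<open>r\<close> is chosen such that \<open>sol a\<close> has norm at most \<open>1/2\<close> at the time \<open>\<delta>\<close> of
  \<open>ode_extends_to_zero\<close>. Dependence on \<open>a\<close> is controlled by \<open>sol_diff_bound\<close> away from \<open>0\<close> and by the
  common Lipschitz constant near \<open>0\<close>; the parameter is recovered at a time \<open>T\<close> when \<open>weight T\<close> is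
  close to \<open>1\<close>.\<close>

lemma solution_family:
  "\<exists>r>0. \<exists>Y. (\<forall>a\<in>bounded_orbits \<inter> cball 0 r. solves_ode_on {0..} (\<lambda>t y. A y + f (t, y)) (Y a)
        \<and> Y a \<in> extensional {0..} \<and> ((\<lambda>t. Y a t - X t a) \<longlongrightarrow> 0) at_top)
     \<and> (\<forall>S. S \<subseteq> bounded_orbits \<inter> cball 0 r \<longrightarrow>
          top_of_set S homeomorphic_space subtopology (compact_open_topology {0..}) (Y ` S))"
proof -
  define F where "F t y = A y + f (t, y)" for t y
  have F: "continuous_on UNIV (\<lambda>(t, y). F t y)"
    unfolding F_def split_beta
    by (intro continuous_intros blinfun.continuous_on continuous_on_compose2[OF f_cont]) auto
  obtain M where M: "M \<ge> 1" "\<And>t v. v \<in> bounded_orbits \<Longrightarrow> norm (X t v) \<le> M * norm v"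
    using uniform_bound_bounded_orbits by blast
  have "compact ((\<lambda>(t, y). F t y) ` ({0..1} \<times> cball 0 1))"
    by (intro compact_continuous_image continuous_on_subset[OF F] compact_Times) auto
  then obtain N where N: "N > 0" "\<And>t y. t \<in> {0..1} \<Longrightarrow> norm y \<le> 1 \<Longrightarrow> norm (F t y) \<le> N"
    using bounded_pos[THEN iffD1, OF compact_imp_bounded] by (force simp: mem_cball)
  define \<delta> where "\<delta> = min 1 (1 / (4 * N))"
  have \<delta>: "\<delta> > 0" "\<delta> \<le> 1" "N * \<delta> < 1/2"
  proof -
    show "\<delta> > 0" "\<delta> \<le> 1" using N(1) by (auto simp: \<delta>_def)
    have "N * \<delta> \<le> N * (1 / (4 * N))" using N(1) by (intro mult_left_mono) (auto simp: \<delta>_def)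
    then show "N * \<delta> < 1/2" using N(1) by simp
  qed
  define r where "r = 1 / (4 * M * weight \<delta>)"
  have r: "r > 0" using M(1) weight_pos[of \<delta>] by (simp add: r_def)
  have diff_bound: "norm (sol a t - sol b t) \<le> 2 * (M * norm (a - b)) * weight t"
      "norm (sol a t - sol b t - X t (a - b)) \<le> M * norm (a - b) * (weight t - 1)"
    if "a \<in> bounded_orbits" "b \<in> bounded_orbits" "t > 0" for a b t
    using sol_diff_bound[OF that(1,2) M(2) that(3)] sol_diff_flow_bound[OF that(1,2) M(2) that(3)]
      real_vector.subspace_diff[OF subspace_bounded_orbits that(1,2)] by auto
  have "norm (sol a \<delta>) \<le> 1/2" if a: "a \<in> bounded_orbits \<inter> cball 0 r" for a
  proof -
    have "norm (sol a \<delta>) \<le> 2 * (M * norm a) * weight \<delta>"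
      using diff_bound(1)[of a 0 \<delta>] a \<delta>(1) zero_bounded_orbits sol_zero by simp
    also have "\<dots> \<le> 2 * (M * r) * weight \<delta>"
      using a M(1) weight_pos[of \<delta>] by (intro mult_right_mono mult_left_mono) auto
    also have "\<dots> = 1/2" using M(1) weight_pos[of \<delta>] by (simp add: r_def)
    finally show ?thesis .
  qed
  then have "\<forall>a\<in>bounded_orbits \<inter> cball 0 r. \<exists>z. (\<forall>t>0. z t = sol a t) \<and> z \<in> extensional {0..}
      \<and> solves_ode_on {0..} F z \<and> N-lipschitz_on {0..\<delta>} z"
    using sol_deriv N(2) \<delta> F by (intro ballI ode_extends_to_zero) (auto simp: F_def)
  then obtain Y where Y: "\<And>a t. a \<in> bounded_orbits \<inter> cball 0 r \<Longrightarrow> t > 0 \<Longrightarrow> Y a t = sol a t"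
    and Yext: "\<And>a. a \<in> bounded_orbits \<inter> cball 0 r \<Longrightarrow> Y a \<in> extensional {0..}"
    and Ysol: "\<And>a. a \<in> bounded_orbits \<inter> cball 0 r \<Longrightarrow> solves_ode_on {0..} F (Y a)"
    and Ylip: "\<And>a. a \<in> bounded_orbits \<inter> cball 0 r \<Longrightarrow> N-lipschitz_on {0..\<delta>} (Y a)"
    by metis
  have lim: "((\<lambda>t. Y a t - X t a) \<longlongrightarrow> 0) at_top" if a: "a \<in> bounded_orbits \<inter> cball 0 r" for a
  proof (rule Lim_null_comparison)
    show "eventually (\<lambda>t. norm (Y a t - X t a) \<le> M * norm a * (weight t - 1)) at_top"
      using eventually_gt_at_top[of 0]
    proof eventually_elim
      case (elim t)
      then show ?case using diff_bound(2)[of a 0 t] a zero_bounded_orbits sol_zero Y[OF a] by simp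
    qed
    have "((\<lambda>t. M * norm a * (weight t - 1)) \<longlongrightarrow> M * norm a * (1 - 1)) at_top"
      by (intro tendsto_intros weight_tendsto_1)
    then show "((\<lambda>t. M * norm a * (weight t - 1)) \<longlongrightarrow> 0) at_top" by simp
  qed
  have "((\<lambda>t. M * (M * (weight t - 1))) \<longlongrightarrow> M * (M * (1 - 1))) at_top"
    by (intro tendsto_intros weight_tendsto_1)
  then have "eventually (\<lambda>t. M * (M * (weight t - 1)) < 1/2) at_top"
    by (rule order_tendstoD) simp
  then have "eventually (\<lambda>t. M * (M * (weight t - 1)) < 1/2 \<and> t > 0) at_top"
    using eventually_gt_at_top[of 0] by (rule eventually_conj)
  then obtain T where T: "M * (M * (weight T - 1)) < 1/2" "T > 0"
    by (auto simp: eventually_at_top_linorder)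
  have hom: "top_of_set S homeomorphic_space subtopology (compact_open_topology {0..}) (Y ` S)"
    if S: "S \<subseteq> bounded_orbits \<inter> cball 0 r" for S
  proof (rule homeomorphic_image_compact_open[where T = T and L = "2 * M"])
    fix a assume a: "a \<in> S"
    have "continuous_on {0..} (Y a)"
      using Ysol[OF subsetD[OF S a]] has_vector_derivative_continuous
      unfolding solves_ode_on_def continuous_on_eq_continuous_within by blast
    then show "Y a \<in> continuous_functions {0..}"
      using Yext[OF subsetD[OF S a]] by (simp add: continuous_functions_def)
  next
    fix a b assume ab: "a \<in> S" "b \<in> S"
    then have ab': "a \<in> bounded_orbits" "b \<in> bounded_orbits" "a - b \<in> bounded_orbits" using S real_vector.subspace_diff[OF subspace_bounded_orbits] by auto
    have "norm (X T (a - b)) \<le> norm (sol a T - sol b T) + M * norm (a - b) * (weight T - 1)"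
      using norm_triangle_ineq3[of "X T (a - b)" "sol a T - sol b T"] diff_bound(2)[OF ab'(1,2) T(2)]
      by (simp add: norm_minus_commute abs_le_iff)
    then have "M * norm (X T (a - b)) \<le> M * (norm (sol a T - sol b T) + M * norm (a - b) * (weight T - 1))"
      using M(1) by (intro mult_left_mono) auto
    moreover have "norm (a - b) \<le> M * norm (X T (a - b))"
      using M(2)[OF X_bounded_orbits[OF ab'(3)], of "- T" T] by simp
    moreover have "M * (M * (weight T - 1)) * norm (a - b) \<le> 1/2 * norm (a - b)"
      using T(1) by (intro mult_right_mono) auto
    ultimately have "norm (a - b) \<le> 2 * M * norm (sol a T - sol b T)"
      by (simp add: algebra_simps)
    then show "dist a b \<le> 2 * M * dist (Y a T) (Y b T)"
      using Y[OF subsetD[OF S ab(1)] T(2)] Y[OF subsetD[OF S ab(2)] T(2)] by (simp add: dist_norm)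
  next
    show "T \<in> {0..}" using T(2) by simp
  next
    fix a and K :: "real set" and \<epsilon> :: real
    assume a: "a \<in> S" and K: "K \<subseteq> {0..}" and \<epsilon>: "\<epsilon> > 0"
    \<comment> \<open>Up to the time \<open>s\<close> each solution moves by at most \<open>\<epsilon>/8\<close>; from then on two solutions
      are \<open>\<epsilon>/2\<close>-close if their parameters are \<open>d\<close>-close.\<close>
    define s where "s = min \<delta> (\<epsilon> / (8 * N))"
    have s: "s > 0" "s \<le> \<delta>" using \<epsilon> N(1) \<delta>(1) by (auto simp: s_def)
    have Ns: "N * s \<le> \<epsilon> / 8"
    proof -
      have "N * s \<le> N * (\<epsilon> / (8 * N))" using N(1) by (intro mult_left_mono) (auto simp: s_def)
      then show ?thesis using N(1) by simp
    qed
    define d where "d = \<epsilon> / (4 * M * weight s)"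
    have d: "d > 0" using \<epsilon> M(1) weight_pos[of s] by (simp add: d_def)
    have "dist (Y a t) (Y b t) < \<epsilon>" if b: "b \<in> S" "dist a b < d" and t: "t \<in> K" for b t
    proof -
      have ab: "a \<in> bounded_orbits \<inter> cball 0 r" "b \<in> bounded_orbits \<inter> cball 0 r" using a b S by auto
      have large: "dist (Y a u) (Y b u) \<le> \<epsilon> / 2" if u: "u \<ge> s" for u
      proof -
        have "dist (Y a u) (Y b u) \<le> 2 * (M * norm (a - b)) * weight u"
          using diff_bound(1)[of a b u] Y[OF ab(1), of u] Y[OF ab(2), of u] u s(1) ab
          by (simp add: dist_norm)
        also have "\<dots> \<le> 2 * (M * d) * weight s"
          using b(2) M(1) d weight_pos[of u] weight_antimono[OF s(1) u]
          by (intro mult_mono mult_left_mono) (auto simp: dist_norm)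
        also have "\<dots> = \<epsilon> / 2" using M(1) weight_pos[of s] by (simp add: d_def)
        finally show ?thesis .
      qed
      show ?thesis
      proof (cases "t \<ge> s")
        case True
        then show ?thesis using large[OF True] \<epsilon> by simp
      next
        case False
        have "0 \<le> t" using t K by auto
        then have st: "dist t s \<le> s" "s \<in> {0..\<delta>}" "t \<in> {0..\<delta>}"
          using False s by (auto simp: dist_real_def)
        have "dist (Y c t) (Y c s) \<le> \<epsilon> / 8" if "c \<in> bounded_orbits \<inter> cball 0 r" for c
        proof -
          have "dist (Y c t) (Y c s) \<le> N * dist t s"
            using lipschitz_onD[OF Ylip[OF that] st(3,2)] .
          also have "\<dots> \<le> N * s" using st N(1) by (intro mult_left_mono) auto
          finally show ?thesis using Ns by simp
        qed
        from this[OF ab(1)] this[OF ab(2)] large[of s] show ?thesis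
          using dist_triangle[of "Y a t" "Y b t" "Y a s"] dist_triangle[of "Y a s" "Y b t" "Y b s"] \<epsilon>
          by (simp add: dist_commute)
      qed
    qed
    then show "\<exists>d>0. \<forall>b\<in>S. dist a b < d \<longrightarrow> (\<forall>t\<in>K. dist (Y a t) (Y b t) < \<epsilon>)"
      using d by blast
  qed
  show ?thesis
    using r Ysol Yext lim hom unfolding F_def by blast
qed

end

section \<open>Exponentials of Jordan matrices\<close>

text \<open>The matrix exponential of \<open>t\<close> times the Jordan block, in closed form.\<close>

definition jordan_block_exp :: "nat \<Rightarrow> complex \<Rightarrow> real \<Rightarrow> complex mat" where
  "jordan_block_exp m \<mu> t = Matrix.mat m m (\<lambda>(i, j).
     if i \<le> j then exp (of_real t * \<mu>) * of_real (t ^ (j - i) / fact (j - i)) else 0)"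

lemma jordan_block_exp_carrier: "jordan_block_exp m \<mu> t \<in> carrier_mat m m"
  by (simp add: jordan_block_exp_def)

lemma jordan_block_exp_0: "jordan_block_exp m \<mu> 0 = 1\<^sub>m m"
  by (rule eq_matI) (auto simp: jordan_block_exp_def power_0_left)

lemma sum_two_terms:
  fixes g :: "nat \<Rightarrow> 'a::comm_ring_1"
  assumes "i < m"
  shows "(\<Sum>k = 0..<m. (if i = k then a else if Suc i = k then 1 else 0) * g k)
    = a * g i + (if Suc i < m then g (Suc i) else 0)"
proof -
  have "(\<Sum>k = 0..<m. (if i = k then a else if Suc i = k then 1 else 0) * g k)
     = (\<Sum>k = 0..<m. (if i = k then a * g k else 0) + (if Suc i = k then g k else 0))"
    by (rule sum.cong) auto
  also have "\<dots> = a * g i + (if Suc i < m then g (Suc i) else 0)"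
    using assms by (simp add: sum.distrib)
  finally show ?thesis .
qed

lemma jordan_block_exp_deriv:
  assumes i: "i < m" and j: "j < m"
  shows "((\<lambda>t. jordan_block_exp m \<mu> t $$ (i, j)) has_vector_derivative
    (jordan_block m \<mu> * jordan_block_exp m \<mu> t) $$ (i, j)) (at t)"
proof -
  have mult: "(jordan_block m \<mu> * jordan_block_exp m \<mu> t) $$ (i, j)
     = \<mu> * jordan_block_exp m \<mu> t $$ (i, j)
       + (if Suc i < m then jordan_block_exp m \<mu> t $$ (Suc i, j) else 0)"
    using i j jordan_block_exp_carrier[of m \<mu> t] sum_two_terms[OF i, of \<mu> "\<lambda>k. jordan_block_exp m \<mu> t $$ (k, j)"]
    by (simp add: scalar_prod_def)
  have exp: "((\<lambda>t. exp (of_real t * \<mu>)) has_vector_derivative \<mu> * exp (of_real t * \<mu>)) (at t)"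
    using exp_scaleR_has_vector_derivative_right[of \<mu> t UNIV] by (simp add: scaleR_conv_of_real mult.commute)
  consider "j < i" | "i = j" | "i < j" by linarith
  then show ?thesis
  proof cases
    case 1
    then show ?thesis unfolding mult using i j by (simp add: jordan_block_exp_def)
  next
    case 2
    then show ?thesis unfolding mult using i j exp by (simp add: jordan_block_exp_def)
  next
    case 3
    define d where "d = j - Suc i"
    have d: "j - i = Suc d" "j = Suc (i + d)" using 3 by (auto simp: d_def)
    have "((\<lambda>t. t ^ Suc d / fact (Suc d)) has_real_derivative (t ^ d / fact d)) (at t)"
    proof -
      have "((\<lambda>t. t ^ Suc d / fact (Suc d)) has_real_derivative (real (Suc d) * t ^ (Suc d - Suc 0) / fact (Suc d))) (at t)"
        by (rule DERIV_cdivide[OF DERIV_pow])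
      then show ?thesis by (simp add: fact_Suc del: of_nat_Suc power_Suc)
    qed
    then have "((\<lambda>t. complex_of_real (t ^ Suc d / fact (Suc d))) has_vector_derivative
        complex_of_real (t ^ d / fact d)) (at t)"
      by (intro has_vector_derivative_of_real)
        (simp add: has_real_derivative_iff_has_vector_derivative)
    from has_vector_derivative_mult[OF exp this]
    show ?thesis
      unfolding mult using i j 3 d by (simp add: jordan_block_exp_def algebra_simps)
  qed
qed

lemma jordan_block_exp_bound:
  assumes i: "i < m" and j: "j < m"
  shows "norm (jordan_block_exp m \<mu> t $$ (i, j)) \<le> (1 + \<bar>t\<bar>) ^ (m - 1) * exp (Re \<mu> * t)"
proof (cases "i \<le> j")
  case True
  have "\<bar>t\<bar> ^ (j - i) / fact (j - i) \<le> (1 + \<bar>t\<bar>) ^ (j - i) / 1"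
    by (intro frac_le power_mono) (auto simp: fact_ge_1)
  also have "\<dots> \<le> (1 + \<bar>t\<bar>) ^ (m - 1)"
    using i j by (simp, intro power_increasing) auto
  finally have "exp (Re \<mu> * t) * (\<bar>t\<bar> ^ (j - i) / fact (j - i)) \<le> exp (Re \<mu> * t) * (1 + \<bar>t\<bar>) ^ (m - 1)"
    by (intro mult_left_mono) auto
  then show ?thesis
    using True i j by (simp add: jordan_block_exp_def norm_mult norm_divide norm_power mult.commute)
next
  case False
  then show ?thesis using i j by (simp add: jordan_block_exp_def)
qed

text \<open>Up to a constant factor, a bound for the exponential of \<open>t\<close> times a matrix with Jordan blocks
  \<open>bs\<close>, for times \<open>t\<close> of either sign.\<close>

definition growth :: "(nat \<times> complex) list \<Rightarrow> real \<Rightarrow> real" where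
  "growth bs t = (\<Sum>(m, \<mu>)\<leftarrow>bs. (1 + \<bar>t\<bar>) ^ (m - 1) * exp (Re \<mu> * t))"

lemma growth_Nil [simp]: "growth [] t = 0"
  and growth_Cons [simp]: "growth ((m, \<mu>) # bs) t = (1 + \<bar>t\<bar>) ^ (m - 1) * exp (Re \<mu> * t) + growth bs t"
  by (simp_all add: growth_def)

lemma growth_nonneg: "growth bs t \<ge> 0"
  by (induction bs) (auto simp: growth_def intro!: add_nonneg_nonneg)

lemma jordan_matrix_exp:
  "\<exists>D. \<forall>t. D t \<in> carrier_mat (sum_list (map fst bs)) (sum_list (map fst bs))
     \<and> D 0 = 1\<^sub>m (sum_list (map fst bs))
     \<and> (\<forall>i < sum_list (map fst bs). \<forall>j < sum_list (map fst bs).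
          ((\<lambda>t. D t $$ (i, j)) has_vector_derivative (jordan_matrix bs * D t) $$ (i, j)) (at t)
          \<and> norm (D t $$ (i, j)) \<le> growth bs t)"
proof (induction bs)
  case Nil
  show ?case by (rule exI[of _ "\<lambda>_. 1\<^sub>m 0"]) auto
next
  case (Cons b bs)
  obtain m \<mu> where b: "b = (m, \<mu>)" by (cases b)
  define n where "n = sum_list (map fst bs)"
  obtain D where D: "\<And>t. D t \<in> carrier_mat n n" "D 0 = 1\<^sub>m n"
    and Dd: "\<And>t i j. i < n \<Longrightarrow> j < n \<Longrightarrow>
      ((\<lambda>t. D t $$ (i, j)) has_vector_derivative (jordan_matrix bs * D t) $$ (i, j)) (at t)"
    and Db: "\<And>t i j. i < n \<Longrightarrow> j < n \<Longrightarrow> norm (D t $$ (i, j)) \<le> growth bs t"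
    using Cons.IH unfolding n_def[symmetric] by blast
  define E where "E t = four_block_mat (jordan_block_exp m \<mu> t) (0\<^sub>m m n) (0\<^sub>m n m) (D t)" for t
  note car = jordan_block_exp_carrier[of m \<mu>] D(1)
  have J: "jordan_matrix bs \<in> carrier_mat n n" unfolding n_def by simp
  have JE: "jordan_matrix (b # bs) * E t = four_block_mat (jordan_block m \<mu> * jordan_block_exp m \<mu> t)
      (0\<^sub>m m n) (0\<^sub>m n m) (jordan_matrix bs * D t)" for t
  proof -
    have "jordan_matrix (b # bs) * E t = four_block_mat
       (jordan_block m \<mu> * jordan_block_exp m \<mu> t + 0\<^sub>m m n * 0\<^sub>m n m)
       (jordan_block m \<mu> * 0\<^sub>m m n + 0\<^sub>m m n * D t)
       (0\<^sub>m n m * jordan_block_exp m \<mu> t + jordan_matrix bs * 0\<^sub>m n m)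
       (0\<^sub>m n m * 0\<^sub>m m n + jordan_matrix bs * D t)"
      unfolding b jordan_matrix_Cons E_def n_def[symmetric]
      by (rule mult_four_block_mat[of _ m m _ n _ n]) (use car J in auto)
    also have "jordan_block m \<mu> * jordan_block_exp m \<mu> t + 0\<^sub>m m n * 0\<^sub>m n m
        = jordan_block m \<mu> * jordan_block_exp m \<mu> t"
      using car(1)[of t] by (intro eq_matI) auto
    also have "jordan_block m \<mu> * 0\<^sub>m m n + 0\<^sub>m m n * D t = 0\<^sub>m m n"
      using car(2)[of t] by (intro eq_matI) auto
    also have "0\<^sub>m n m * jordan_block_exp m \<mu> t + jordan_matrix bs * 0\<^sub>m n m = 0\<^sub>m n m"
      using car(1)[of t] J by (intro eq_matI) auto
    also have "0\<^sub>m n m * 0\<^sub>m m n + jordan_matrix bs * D t = jordan_matrix bs * D t"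
      using car(2)[of t] J by (intro eq_matI) auto
    finally show ?thesis .
  qed
  have sum: "sum_list (map fst (b # bs)) = m + n" by (simp add: b n_def)
  have Ecar: "E t \<in> carrier_mat (m + n) (m + n)" for t
    unfolding E_def using car by (intro four_block_carrier_mat)
  have E0: "E 0 = 1\<^sub>m (m + n)"
    unfolding E_def jordan_block_exp_0 D(2) by simp
  have g: "growth (b # bs) t \<ge> growth bs t"
      "growth (b # bs) t \<ge> (1 + \<bar>t\<bar>) ^ (m - 1) * exp (Re \<mu> * t)" for t
    using growth_nonneg[of bs t] by (simp_all add: b)
  have entry: "four_block_mat G (0\<^sub>m m n) (0\<^sub>m n m) H $$ (i, j) =
        (if i < m then if j < m then G $$ (i, j) else 0 else if j < m then 0 else H $$ (i - m, j - m))"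
    if "G \<in> carrier_mat m m" "H \<in> carrier_mat n n" "i < m + n" "j < m + n" for G H :: "complex mat" and i j
    using that by auto
  have idx: "E t $$ (i, j) = (if i < m then if j < m then jordan_block_exp m \<mu> t $$ (i, j) else 0
        else if j < m then 0 else D t $$ (i - m, j - m))"
      "(jordan_matrix (b # bs) * E t) $$ (i, j) =
        (if i < m then if j < m then (jordan_block m \<mu> * jordan_block_exp m \<mu> t) $$ (i, j) else 0
        else if j < m then 0 else (jordan_matrix bs * D t) $$ (i - m, j - m))"
    if "i < m + n" "j < m + n" for i j t
    unfolding JE unfolding E_def
    by (rule entry[OF car that], rule entry[OF mult_carrier_mat mult_carrier_mat that])
      (use car J in auto)
  show ?case
    unfolding sum
  proof (intro exI[of _ E] allI conjI impI)
    fix t i j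
    assume ij: "i < m + n" "j < m + n"
    show "((\<lambda>t. E t $$ (i, j)) has_vector_derivative (jordan_matrix (b # bs) * E t) $$ (i, j)) (at t)"
      unfolding idx[OF ij] using ij jordan_block_exp_deriv Dd by auto
    show "norm (E t $$ (i, j)) \<le> growth (b # bs) t"
    proof -
      have "norm (E t $$ (i, j)) \<le> (1 + \<bar>t\<bar>) ^ (m - 1) * exp (Re \<mu> * t) \<or> norm (E t $$ (i, j)) \<le> growth bs t"
        unfolding idx[OF ij] using ij jordan_block_exp_bound[of i m j \<mu> t] Db[of "i - m" "j - m" t]
          growth_nonneg[of bs t] by auto
      then show ?thesis using g[of t] by linarith
    qed
  qed (use Ecar E0 in auto)
qed

text \<open>The fundamental matrix \<open>P e\<^sup>t\<^sup>J P\<^sup>-\<^sup>1\<close>.\<close>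

lemma jordan_nf_flow:
  fixes A :: "complex mat"
  assumes A: "A \<in> carrier_mat n n" and nf: "jordan_nf A bs"
  shows "\<exists>E K. \<forall>t. E t \<in> carrier_mat n n \<and> E 0 = 1\<^sub>m n
     \<and> (\<forall>i < n. \<forall>j < n. ((\<lambda>t. E t $$ (i, j)) has_vector_derivative (A * E t) $$ (i, j)) (at t)
          \<and> norm (E t $$ (i, j)) \<le> K * growth bs t)"
proof -
  have "similar_mat A (jordan_matrix bs)" using nf by (simp add: jordan_nf_def)
  then obtain P Q where "similar_mat_wit A (jordan_matrix bs) P Q" unfolding similar_mat_def by blast
  from similar_mat_witD2[OF A this]
  have PQ: "P * Q = 1\<^sub>m n" "Q * P = 1\<^sub>m n" "A = P * jordan_matrix bs * Q"
    and J: "jordan_matrix bs \<in> carrier_mat n n"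
    and P: "P \<in> carrier_mat n n" and Q: "Q \<in> carrier_mat n n" by auto
  have sum: "sum_list (map fst bs) = n"
    by (metis J carrier_matD(1) jordan_matrix_dim(1))
  obtain D where D: "\<And>t. D t \<in> carrier_mat n n" "D 0 = 1\<^sub>m n"
    and Dd: "\<And>t i j. i < n \<Longrightarrow> j < n \<Longrightarrow>
      ((\<lambda>t. D t $$ (i, j)) has_vector_derivative (jordan_matrix bs * D t) $$ (i, j)) (at t)"
    and Db: "\<And>t i j. i < n \<Longrightarrow> j < n \<Longrightarrow> norm (D t $$ (i, j)) \<le> growth bs t"
    using jordan_matrix_exp[of bs] unfolding sum by blast
  define E where "E t = P * D t * Q" for t
  have PDQ: "(P * M * Q) $$ (i, j) = (\<Sum>k<n. \<Sum>l<n. P $$ (i, k) * (M $$ (k, l) * Q $$ (l, j)))"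
    if "i < n" "j < n" "M \<in> carrier_mat n n" for i j and M :: "complex mat"
    using that P Q by (simp add: scalar_prod_def sum_distrib_left lessThan_atLeast0)
  have AE: "A * E t = P * (jordan_matrix bs * D t) * Q" for t
  proof -
    have "A * E t = P * jordan_matrix bs * (Q * P) * D t * Q"
      unfolding PQ(3) E_def using P Q J D(1)[of t] by (simp add: assoc_mult_mat[of _ n n _ n _ n])
    then show ?thesis
      unfolding PQ(2) using P Q J D(1)[of t] by (simp add: assoc_mult_mat[of _ n n _ n _ n])
  qed
  define K where "K = (\<Sum>i<n. \<Sum>j<n. \<Sum>k<n. \<Sum>l<n. norm (P $$ (i, k)) * norm (Q $$ (l, j)))"
  have JD: "jordan_matrix bs * D t \<in> carrier_mat n n" for t using J D(1) by auto
  show ?thesis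
  proof (intro exI[of _ E] exI[of _ K] allI conjI impI)
    fix t
    show "E t \<in> carrier_mat n n" unfolding E_def using P Q D(1)[of t] by auto
    show "E 0 = 1\<^sub>m n" unfolding E_def D(2) using P PQ(1) by simp
    fix i j assume ij: "i < n" "j < n"
    show "((\<lambda>t. E t $$ (i, j)) has_vector_derivative (A * E t) $$ (i, j)) (at t)"
      unfolding AE PDQ[OF ij JD] unfolding E_def PDQ[OF ij D(1)]
      by (intro has_vector_derivative_sum has_vector_derivative_mult_left
          has_vector_derivative_mult_right Dd) auto
    have "norm (E t $$ (i, j)) \<le> (\<Sum>k<n. \<Sum>l<n. norm (P $$ (i, k)) * (growth bs t * norm (Q $$ (l, j))))"
      unfolding E_def PDQ[OF ij D(1)]
      by (intro sum_norm_le) (auto simp: norm_mult intro!: mult_mono Db growth_nonneg mult_nonneg_nonneg)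
    also have "\<dots> = (\<Sum>k<n. \<Sum>l<n. norm (P $$ (i, k)) * norm (Q $$ (l, j))) * growth bs t"
      unfolding sum_distrib_right by (intro sum.cong refl) simp
    also have "\<dots> \<le> K * growth bs t"
    proof (intro mult_right_mono growth_nonneg)
      let ?g = "\<lambda>i j. \<Sum>k<n. \<Sum>l<n. norm (P $$ (i, k)) * norm (Q $$ (l, j))"
      have "?g i j \<le> (\<Sum>j<n. ?g i j)"
        using ij by (intro member_le_sum) (auto intro!: sum_nonneg)
      also have "\<dots> \<le> K"
        unfolding K_def using ij
        by (intro member_le_sum[of i "{..<n}" "\<lambda>i. \<Sum>j<n. ?g i j"]) (auto intro!: sum_nonneg)
      finally show "?g i j \<le> K" .
    qed
    finally show "norm (E t $$ (i, j)) \<le> K * growth bs t" .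
  qed
qed

section \<open>The flow of a real matrix\<close>

lemma jordan_matrix_eigenvalue:
  fixes A :: "complex mat"
  assumes A: "A \<in> carrier_mat n n" and nf: "jordan_nf A bs"
  shows "eigenvalue A \<mu> \<longleftrightarrow> (\<exists>m. (m, \<mu>) \<in> set bs)"
proof -
  have "eigenvalue A \<mu> \<longleftrightarrow> (\<Prod>(m, a)\<leftarrow>bs. poly ([:- a, 1:] ^ m) \<mu>) = 0"
    unfolding eigenvalue_root_char_poly[OF A] jordan_nf_char_poly[OF nf]
    by (simp add: poly_prod_list o_def split_def)
  also have "\<dots> \<longleftrightarrow> (\<exists>(m, a)\<in>set bs. m \<noteq> 0 \<and> \<mu> = a)"
    unfolding prod_list_zero_iff by (force simp: poly_power split_def)
  also have "\<dots> \<longleftrightarrow> (\<exists>m. (m, \<mu>) \<in> set bs)"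
    using nf unfolding jordan_nf_def by (force simp: split_def)
  finally show ?thesis .
qed

lemma complex_mat_of_carrier: "complex_mat_of (C :: real^'n^'n) \<in> carrier_mat CARD('n) CARD('n)"
  by (simp add: complex_mat_of_def)

lemma complex_mat_of_jordan_nf:
  fixes C :: "real^'n^'n"
  obtains bs where "jordan_nf (complex_mat_of C) bs"
  using char_poly_factorized[OF complex_mat_of_carrier] jordan_nf_exists[OF complex_mat_of_carrier]
  by metis

lemma jordan_nf_dim:
  fixes A :: "complex mat"
  assumes A: "A \<in> carrier_mat n n" and nf: "jordan_nf A bs"
  shows "sum_list (map fst bs) = n"
proof -
  have "similar_mat A (jordan_matrix bs)" using nf by (simp add: jordan_nf_def)
  then obtain P Q where "similar_mat_wit A (jordan_matrix bs) P Q" unfolding similar_mat_def by blast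
  from similar_mat_witD2(5)[OF A this] show ?thesis
    by (metis carrier_matD(1) jordan_matrix_dim(1))
qed

lemma eigenvalues_jordan_nf:
  fixes C :: "real^'n^'n"
  assumes "jordan_nf (complex_mat_of C) bs"
  shows "eigenvalues C = snd ` set bs"
  unfolding eigenvalues_def jordan_matrix_eigenvalue[OF complex_mat_of_carrier assms] by force

text \<open>Finiteness of the set of degrees is what makes its maximum meaningful: a block is never
  larger than the matrix.\<close>

lemma block_size_le_max_divisor_degree:
  fixes C :: "real^'n^'n"
  assumes nf: "jordan_nf (complex_mat_of C) bs" and b: "(m, \<mu>) \<in> set bs"
  shows "m \<le> max_divisor_degree C (Re \<mu>)" "m \<ge> 1"
proof -
  let ?D = "degree ` {p \<in> elementary_divisors C. \<exists>\<nu>. poly p \<nu> = 0 \<and> Re \<nu> = Re \<mu>}"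
  show m: "m \<ge> 1" using nf b by (force simp: jordan_nf_def)
  have "finite ?D"
  proof (rule finite_subset[of _ "{..CARD('n)}"])
    show "?D \<subseteq> {..CARD('n)}"
    proof safe
      fix q assume "q \<in> elementary_divisors C"
      then obtain k \<nu> cs where q: "q = [:-\<nu>, 1:] ^ k" and cs: "jordan_nf (complex_mat_of C) cs" "(k, \<nu>) \<in> set cs"
        unfolding elementary_divisors_def by blast
      have "k \<le> sum_list (map fst cs)"
        using cs(2) by (intro member_le_sum_list) (force+)
      then show "degree q \<le> CARD('n)"
        using jordan_nf_dim[OF complex_mat_of_carrier cs(1)] by (simp add: q degree_linear_power)
    qed
  qed simp
  moreover have "m \<in> ?D"
  proof (rule image_eqI[of _ _ "[:-\<mu>, 1:] ^ m"])
    show "m = degree ([:-\<mu>, 1:] ^ m)" by (simp add: degree_linear_power)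
    have "poly ([:-\<mu>, 1:] ^ m) \<mu> = 0" using m by (simp add: poly_power)
    then show "[:-\<mu>, 1:] ^ m \<in> {p \<in> elementary_divisors C. \<exists>\<nu>. poly p \<nu> = 0 \<and> Re \<nu> = Re \<mu>}"
      unfolding elementary_divisors_def using nf b by blast
  qed
  ultimately show "m \<le> max_divisor_degree C (Re \<mu>)"
    unfolding max_divisor_degree_def by (rule Max_ge)
qed

text \<open>The operator of the matrix unit at \<open>(a, b)\<close>.\<close>

definition unit_blinfun :: "'n \<Rightarrow> 'n \<Rightarrow> (real^'n) \<Rightarrow>\<^sub>L (real^'n)" where
  "unit_blinfun a b = Blinfun (\<lambda>v. vec_nth v b *\<^sub>R axis a 1)"

lemma unit_blinfun_apply:
  fixes v :: "real^'n"
  shows "vec_nth (unit_blinfun a b v) c = (if c = a then vec_nth v b else 0)"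
proof -
  have "bounded_linear (\<lambda>v :: real^'n. vec_nth v b *\<^sub>R (axis a 1 :: real^'n))"
    by (intro bounded_linear_compose[OF bounded_linear_scaleR_left] bounded_linear_vec_nth)
  then have "unit_blinfun a b v = vec_nth v b *\<^sub>R axis a 1"
    unfolding unit_blinfun_def by (simp add: bounded_linear_Blinfun_apply)
  then show ?thesis by (simp add: axis_def)
qed

text \<open>Since \<open>C\<close> is real, the real part of a complex fundamental matrix is again a fundamental matrix.\<close>

lemma complex_mat_of_flow:
  fixes C :: "real^'n^'n"
  assumes nf: "jordan_nf (complex_mat_of C) bs"
  obtains X K where "linear_flow (Blinfun ((*v) C)) X" "\<And>t. norm (X t) \<le> K * growth bs t"
proof -
  define n where "n = CARD('n)"
  define A where "A = complex_mat_of C"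
  define e :: "nat \<Rightarrow> 'n" where "e = from_nat_into UNIV"
  define ix where "ix = inv_into {..<n} e"
  have bij: "bij_betw e {..<n} UNIV"
    unfolding e_def n_def by (rule bij_betw_from_nat_into_finite) simp
  have ix: "ix a < n" "e (ix a) = a" for a
    using bij_betw_inv_into_right[OF bij UNIV_I, of a] bij_betwE[OF bij_betw_inv_into[OF bij], rule_format, of a]
    by (auto simp: ix_def)
  have ixe: "ix (e i) = i" if "i < n" for i
    using bij_betw_inv_into_left[OF bij] that by (simp add: ix_def)
  have inj: "ix a = ix b \<longleftrightarrow> a = b" for a b using ix(2) by metis
  have reindex: "(\<Sum>i<n. g i) = (\<Sum>a\<in>UNIV. g (ix a))" for g :: "nat \<Rightarrow> complex"
    using sum.reindex_bij_betw[OF bij, of "\<lambda>a. g (ix a)"] ixe by simp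
  have A: "A \<in> carrier_mat n n" "\<And>a b. A $$ (ix a, ix b) = of_real (vec_nth (vec_nth C a) b)"
    unfolding A_def n_def using ix
    by (auto simp: complex_mat_of_def n_def e_def)
  obtain E K where E: "\<And>t. E t \<in> carrier_mat n n" "E 0 = 1\<^sub>m n"
    and Ed: "\<And>t i j. i < n \<Longrightarrow> j < n \<Longrightarrow> ((\<lambda>t. E t $$ (i, j)) has_vector_derivative (A * E t) $$ (i, j)) (at t)"
    and Eb: "\<And>t i j. i < n \<Longrightarrow> j < n \<Longrightarrow> norm (E t $$ (i, j)) \<le> K * growth bs t"
    using jordan_nf_flow[OF A(1) nf[folded A_def]] by blast
  define x where "x t a b = Re (E t $$ (ix a, ix b))" for t a b
  have xd: "((\<lambda>t. x t a b) has_vector_derivative (\<Sum>c\<in>UNIV. vec_nth (vec_nth C a) c * x t c b)) (at t)" for t a b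
  proof -
    have "(A * E t) $$ (ix a, ix b) = (\<Sum>i<n. A $$ (ix a, i) * E t $$ (i, ix b))"
      using A(1) E(1)[of t] ix by (simp add: scalar_prod_def lessThan_atLeast0)
    also have "\<dots> = (\<Sum>c\<in>UNIV. of_real (vec_nth (vec_nth C a) c) * E t $$ (ix c, ix b))"
      unfolding reindex A(2) ..
    finally have "Re ((A * E t) $$ (ix a, ix b)) = (\<Sum>c\<in>UNIV. vec_nth (vec_nth C a) c * x t c b)"
      by (simp add: x_def)
    then show ?thesis
      using bounded_linear.has_vector_derivative[OF bounded_linear_Re Ed[OF ix(1) ix(1)], of a b t]
      by (simp add: x_def)
  qed
  define X where "X t = (\<Sum>a\<in>UNIV. \<Sum>b\<in>UNIV. x t a b *\<^sub>R unit_blinfun a b)" for t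
  have X_apply: "vec_nth (X t v) a = (\<Sum>b\<in>UNIV. x t a b * vec_nth v b)" for t v a
  proof -
    have "vec_nth (X t v) a = (\<Sum>c\<in>UNIV. \<Sum>b\<in>UNIV. x t c b * vec_nth (unit_blinfun c b v) a)"
      by (simp add: X_def blinfun.sum_left blinfun.scaleR_left)
    also have "\<dots> = (\<Sum>c\<in>UNIV. if a = c then (\<Sum>b\<in>UNIV. x t c b * vec_nth v b) else 0)"
      by (intro sum.cong) (auto simp: unit_blinfun_apply)
    finally show ?thesis by simp
  qed
  have C_apply: "Blinfun ((*v) C) v = C *v v" for v
    by (simp add: bounded_linear_Blinfun_apply matrix_vector_mul_bounded_linear)
  show ?thesis
  proof
    show "linear_flow (Blinfun ((*v) C)) X"
    proof
      fix t
      have "(X has_vector_derivative (\<Sum>a\<in>UNIV. \<Sum>b\<in>UNIV.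
          (\<Sum>c\<in>UNIV. vec_nth (vec_nth C a) c * x t c b) *\<^sub>R unit_blinfun a b)) (at t)"
        unfolding X_def
        by (intro has_vector_derivative_sum
            bounded_linear.has_vector_derivative[OF bounded_linear_scaleR_left] xd)
      moreover have "(\<Sum>a\<in>UNIV. \<Sum>b\<in>UNIV.
          (\<Sum>c\<in>UNIV. vec_nth (vec_nth C a) c * x t c b) *\<^sub>R unit_blinfun a b) = Blinfun ((*v) C) o\<^sub>L X t"
        (is "?L = ?R")
      proof (rule blinfun_eqI)
        fix v
        show "?L v = ?R v"
        proof (rule Finite_Cartesian_Product.vec_eq_iff[THEN iffD2], rule allI)
          fix a
          have "vec_nth (?L v) a = (\<Sum>a'\<in>UNIV. \<Sum>b\<in>UNIV.
            (\<Sum>c\<in>UNIV. vec_nth (vec_nth C a') c * x t c b) * vec_nth (unit_blinfun a' b v) a)"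
            by (simp add: blinfun.sum_left blinfun.scaleR_left)
          also have "\<dots> = (\<Sum>a'\<in>UNIV. if a = a' then \<Sum>b\<in>UNIV.
            (\<Sum>c\<in>UNIV. vec_nth (vec_nth C a') c * x t c b) * vec_nth v b else 0)"
            by (intro sum.cong) (auto simp: unit_blinfun_apply)
          also have "\<dots> = (\<Sum>b\<in>UNIV. (\<Sum>c\<in>UNIV. vec_nth (vec_nth C a) c * x t c b) * vec_nth v b)"
            by simp
          also have "\<dots> = (\<Sum>c\<in>UNIV. \<Sum>b\<in>UNIV. vec_nth (vec_nth C a) c * (x t c b * vec_nth v b))"
            by (subst sum.swap) (simp add: sum_distrib_right mult.assoc)
          also have "\<dots> = vec_nth (?R v) a"
            by (simp add: C_apply matrix_vector_mult_def X_apply sum_distrib_left)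
          finally show "vec_nth (?L v) a = vec_nth (?R v) a" .
        qed
      qed
      ultimately show "(X has_vector_derivative Blinfun ((*v) C) o\<^sub>L X t) (at t)" by simp
    next
      show "X 0 = id_blinfun"
      proof (rule blinfun_eqI)
        fix v
        show "X 0 v = id_blinfun v"
          unfolding Finite_Cartesian_Product.vec_eq_iff X_apply x_def E(2) using ix(1)
          by (simp add: inj if_distrib[where f = Re] if_distrib[where f = "\<lambda>z. z * _"] cong: if_cong)
      qed
    qed
    fix t
    have "norm (X t) \<le> (\<Sum>a\<in>UNIV. \<Sum>b\<in>UNIV. K * growth bs t * norm (unit_blinfun a b :: (real^'n) \<Rightarrow>\<^sub>L (real^'n)))"
      unfolding X_def
    proof (intro sum_norm_le)
      fix a b
      have "\<bar>x t a b\<bar> \<le> K * growth bs t"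
        using abs_Re_le_cmod order_trans Eb[OF ix(1) ix(1)] unfolding x_def by blast
      then show "norm (x t a b *\<^sub>R unit_blinfun a b) \<le> K * growth bs t * norm (unit_blinfun a b :: (real^'n) \<Rightarrow>\<^sub>L (real^'n))"
        by (auto intro!: mult_right_mono)
    qed
    also have "\<dots> = (\<Sum>a\<in>UNIV. \<Sum>b\<in>UNIV. K * norm (unit_blinfun a b :: (real^'n) \<Rightarrow>\<^sub>L (real^'n))) * growth bs t"
      unfolding sum_distrib_right by (intro sum.cong refl) simp
    finally show "norm (X t) \<le> (\<Sum>a\<in>UNIV. \<Sum>b\<in>UNIV. K * norm (unit_blinfun a b :: (real^'n) \<Rightarrow>\<^sub>L (real^'n))) * growth bs t" .
  qed
qed

section \<open>Growth rates\<close>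

text \<open>With \<open>d = min 1 (c/k)\<close> one has \<open>d (1 + \<tau>) \<le> 1 + c\<tau>/k \<le> e^(c\<tau>/k)\<close>; take \<open>k\<close>-th powers.\<close>

lemma power_exp_bounded:
  fixes c :: real
  assumes c: "c > 0"
  shows "\<exists>K\<ge>0. \<forall>\<tau>\<ge>0. (1 + \<tau>) ^ k * exp (- c * \<tau>) \<le> K"
proof (cases "k = 0")
  case True
  then show ?thesis using c by (intro exI[of _ 1]) auto
next
  case False
  define d where "d = min 1 (c / k)"
  have d: "d > 0" using c False by (simp add: d_def)
  have "(1 + \<tau>) ^ k * exp (- c * \<tau>) \<le> 1 / d ^ k" if \<tau>: "\<tau> \<ge> 0" for \<tau>
  proof -
    have "d * (1 + \<tau>) \<le> 1 + (c / k) * \<tau>"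
      using \<tau> mult_right_mono[of d "c / k" \<tau>] by (simp add: d_def algebra_simps)
    also have "\<dots> \<le> exp ((c / k) * \<tau>)" by (rule exp_ge_add_one_self)
    finally have "(d * (1 + \<tau>)) ^ k \<le> exp ((c / k) * \<tau>) ^ k"
      using d \<tau> by (intro power_mono) auto
    also have "\<dots> = exp (c * \<tau>)"
      using False by (simp flip: exp_of_nat_mult)
    finally have "d ^ k * (1 + \<tau>) ^ k * exp (- c * \<tau>) \<le> exp (c * \<tau>) * exp (- c * \<tau>)"
      by (intro mult_right_mono) (auto simp: power_mult_distrib)
    then show ?thesis
      using d by (simp add: exp_minus field_simps)
  qed
  then show ?thesis using d by (intro exI[of _ "1 / d ^ k"]) auto
qed

lemma power_exp_tendsto_0:
  fixes c :: real
  assumes c: "c > 0"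
  shows "((\<lambda>\<tau>. (1 + \<tau>) ^ k * exp (- c * \<tau>)) \<longlongrightarrow> 0) at_top"
proof -
  obtain K where K: "\<And>\<tau>. \<tau> \<ge> 0 \<Longrightarrow> (1 + \<tau>) ^ Suc k * exp (- c * \<tau>) \<le> K"
    using power_exp_bounded[OF c, of "Suc k"] by blast
  show ?thesis
  proof (rule Lim_null_comparison)
    show "eventually (\<lambda>\<tau>. norm ((1 + \<tau>) ^ k * exp (- c * \<tau>)) \<le> K / (1 + \<tau>)) at_top"
      using eventually_ge_at_top[of 0]
    proof eventually_elim
      case (elim \<tau>)
      then show ?case using K[OF elim] by (simp add: field_simps)
    qed
    show "((\<lambda>\<tau>. K / (1 + \<tau>)) \<longlongrightarrow> 0) at_top"
      by (intro tendsto_divide_0[OF tendsto_const] filterlim_at_top_imp_at_infinity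
          filterlim_tendsto_add_at_top[OF tendsto_const] filterlim_ident)
  qed
qed

text \<open>The sign \<open>\<sigma>\<close> selects the direction of time.\<close>

lemma growth_tendsto_0:
  assumes \<sigma>: "\<bar>\<sigma>\<bar> = 1" and neg: "\<And>m \<mu>. (m, \<mu>) \<in> set bs \<Longrightarrow> \<sigma> * Re \<mu> < 0"
  shows "((\<lambda>\<tau>. growth bs (\<sigma> * \<tau>)) \<longlongrightarrow> 0) at_top"
  using neg
proof (induction bs)
  case (Cons b bs)
  obtain m \<mu> where b: "b = (m, \<mu>)" by (cases b)
  have "((\<lambda>\<tau>. (1 + \<tau>) ^ (m - 1) * exp (- (- (\<sigma> * Re \<mu>)) * \<tau>)) \<longlongrightarrow> 0) at_top"
    using Cons.prems[of m \<mu>] by (intro power_exp_tendsto_0) (auto simp: b)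
  moreover have "eventually (\<lambda>\<tau>. (1 + \<tau>) ^ (m - 1) * exp (- (- (\<sigma> * Re \<mu>)) * \<tau>)
      = (1 + \<bar>\<sigma> * \<tau>\<bar>) ^ (m - 1) * exp (Re \<mu> * (\<sigma> * \<tau>))) at_top"
    using eventually_ge_at_top[of 0]
    by eventually_elim (simp add: abs_mult \<sigma> mult_ac)
  ultimately have "((\<lambda>\<tau>. (1 + \<bar>\<sigma> * \<tau>\<bar>) ^ (m - 1) * exp (Re \<mu> * (\<sigma> * \<tau>))) \<longlongrightarrow> 0) at_top"
    by (rule Lim_transform_eventually)
  moreover have "((\<lambda>\<tau>. growth bs (\<sigma> * \<tau>)) \<longlongrightarrow> 0) at_top"
    by (rule Cons.IH, rule Cons.prems) auto
  ultimately show ?case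
    using tendsto_add[of _ 0 at_top _ 0] by (simp add: b)
qed simp

text \<open>Blocks with real part \<open>\<alpha>\<close> contribute at most \<open>(1+s)^(m\<^sub>\<alpha>-1) e^(-\<alpha>s)\<close>, because \<open>s - t \<le> s\<close> and
  \<open>-\<alpha> \<ge> 0\<close>. For the other blocks the powers are absorbed by the strictly smaller exponential rate.
  The remaining factor \<open>(1+s)^(m\<^sub>\<beta>-1) e^(\<beta>s)\<close> is at least \<open>1\<close>.\<close>

lemma growth_backward_bound:
  assumes \<alpha>\<beta>: "\<alpha> \<le> 0" "0 \<le> \<beta>" and m: "m\<^sub>\<alpha> \<ge> 1" "m\<^sub>\<beta> \<ge> 1"
    and min: "\<And>m \<mu>. (m, \<mu>) \<in> set bs \<Longrightarrow> \<alpha> \<le> Re \<mu>"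
    and deg: "\<And>m \<mu>. (m, \<mu>) \<in> set bs \<Longrightarrow> Re \<mu> = \<alpha> \<Longrightarrow> m \<le> m\<^sub>\<alpha>"
  shows "\<exists>K\<ge>0. \<forall>t s. 0 \<le> t \<longrightarrow> t \<le> s \<longrightarrow>
    growth bs (t - s) \<le> K * ((1 + s) ^ (m\<^sub>\<beta> + m\<^sub>\<alpha> - 2) * exp ((\<beta> - \<alpha>) * s))"
  using min deg
proof (induction bs)
  case Nil
  then show ?case by (intro exI[of _ 0]) auto
next
  case (Cons b bs)
  obtain m \<mu> where b: "b = (m, \<mu>)" by (cases b)
  let ?M = "\<lambda>s. (1 + s) ^ (m\<^sub>\<beta> + m\<^sub>\<alpha> - 2) * exp ((\<beta> - \<alpha>) * s)"
  obtain K where K: "K \<ge> 0" "\<And>t s. 0 \<le> t \<Longrightarrow> t \<le> s \<Longrightarrow> growth bs (t - s) \<le> K * ?M s"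
    using Cons.IH Cons.prems by (metis list.set_intros(2))
  have "\<exists>L\<ge>0. \<forall>t s. 0 \<le> t \<longrightarrow> t \<le> s \<longrightarrow> (1 + (s - t)) ^ (m - 1) * exp (- Re \<mu> * (s - t)) \<le> L * ?M s"
  proof (cases "Re \<mu> = \<alpha>")
    case True
    have "(1 + (s - t)) ^ (m - 1) * exp (- Re \<mu> * (s - t)) \<le> 1 * ?M s" if ts: "0 \<le> t" "t \<le> s" for t s
    proof -
      have "m \<le> m\<^sub>\<alpha>" using Cons.prems(2)[of m \<mu>] True by (simp add: b)
      then have "(1 + (s - t)) ^ (m - 1) \<le> (1 + s) ^ (m - 1)" "(1 + s) ^ (m - 1) \<le> (1 + s) ^ (m\<^sub>\<beta> + m\<^sub>\<alpha> - 2)"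
        using ts m by (auto intro!: power_mono power_increasing)
      moreover have "exp (- Re \<mu> * (s - t)) \<le> exp ((\<beta> - \<alpha>) * s)"
      proof -
        have "- \<alpha> * (s - t) \<le> - \<alpha> * s" using \<alpha>\<beta>(1) ts by (intro mult_left_mono) auto
        also have "\<dots> \<le> (\<beta> - \<alpha>) * s" using \<alpha>\<beta>(2) ts by (intro mult_right_mono) auto
        finally show ?thesis by (simp add: True)
      qed
      ultimately show ?thesis
        using ts by (simp, intro mult_mono) auto
    qed
    then show ?thesis by (intro exI[of _ 1]) auto
  next
    case False
    then have "Re \<mu> - \<alpha> > 0" using Cons.prems(1)[of m \<mu>] by (simp add: b)
    from power_exp_bounded[OF this, of "m - 1"] obtain L where
      L: "L \<ge> 0" "\<And>\<tau>. \<tau> \<ge> 0 \<Longrightarrow> (1 + \<tau>) ^ (m - 1) * exp (- (Re \<mu> - \<alpha>) * \<tau>) \<le> L" by blast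
    have "(1 + (s - t)) ^ (m - 1) * exp (- Re \<mu> * (s - t)) \<le> L * ?M s" if ts: "0 \<le> t" "t \<le> s" for t s
    proof -
      have "(1 + (s - t)) ^ (m - 1) * exp (- Re \<mu> * (s - t))
          = ((1 + (s - t)) ^ (m - 1) * exp (- (Re \<mu> - \<alpha>) * (s - t))) * exp (- \<alpha> * (s - t))"
        by (simp flip: exp_add add: algebra_simps)
      also have "\<dots> \<le> L * exp (- \<alpha> * (s - t))"
        using ts by (intro mult_right_mono L(2)) auto
      also have "\<dots> \<le> L * ?M s"
      proof (intro mult_left_mono L(1))
        have "- \<alpha> * (s - t) \<le> - \<alpha> * s" using \<alpha>\<beta>(1) ts by (intro mult_left_mono) auto
        also have "\<dots> \<le> (\<beta> - \<alpha>) * s" using \<alpha>\<beta>(2) ts by (intro mult_right_mono) auto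
        finally have "exp (- \<alpha> * (s - t)) \<le> 1 * exp ((\<beta> - \<alpha>) * s)" by simp
        also have "\<dots> \<le> ?M s" using ts by (intro mult_right_mono one_le_power) auto
        finally show "exp (- \<alpha> * (s - t)) \<le> ?M s" .
      qed
      finally show ?thesis .
    qed
    then show ?thesis using L(1) by (intro exI[of _ L]) auto
  qed
  then obtain L where L: "L \<ge> 0" "\<And>t s. 0 \<le> t \<Longrightarrow> t \<le> s \<Longrightarrow>
      (1 + (s - t)) ^ (m - 1) * exp (- Re \<mu> * (s - t)) \<le> L * ?M s" by blast
  have "growth (b # bs) (t - s) \<le> (L + K) * ?M s" if ts: "0 \<le> t" "t \<le> s" for t s
  proof -
    have "growth (b # bs) (t - s) = (1 + (s - t)) ^ (m - 1) * exp (- Re \<mu> * (s - t)) + growth bs (t - s)"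
      using ts by (simp add: b algebra_simps)
    then show ?thesis
      using L(2)[OF ts] K(2)[OF ts] by (simp only: distrib_right)
  qed
  then show ?case using K(1) L(1) by (intro exI[of _ "L + K"]) auto
qed

text \<open>Away from \<open>0\<close> the quotient \<open>(1 + t) / t\<close> is bounded.\<close>

lemma shifted_power_integrable:
  fixes \<eta> :: "real \<Rightarrow> real"
  assumes nonneg: "\<And>t. t \<ge> 0 \<Longrightarrow> \<eta> t \<ge> 0"
    and int: "(\<lambda>t. t ^ m * exp (c * t) * \<eta> t) integrable_on {0..}" and d: "d > 0"
  shows "(\<lambda>t. (1 + t) ^ m * exp (c * t) * \<eta> t) integrable_on {d..}"
proof -
  let ?g = "\<lambda>t. ((1 + t) / t) ^ m"
  have "(\<lambda>t. t ^ m * exp (c * t) * \<eta> t) absolutely_integrable_on {0..}"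
    using nonneg by (intro nonnegative_absolutely_integrable_1 int) auto
  then have ai: "(\<lambda>t. t ^ m * exp (c * t) * \<eta> t) absolutely_integrable_on {d..}"
    by (rule set_integrable_subset) (use d in auto)
  have "(\<lambda>t. ?g t * (t ^ m * exp (c * t) * \<eta> t)) absolutely_integrable_on {d..}"
  proof (rule absolutely_integrable_bounded_measurable_product_real[OF _ _ _ ai])
    show "?g \<in> borel_measurable (lebesgue_on {d..})"
      using d by (intro continuous_imp_measurable_on_sets_lebesgue continuous_intros) auto
    show "bounded (?g ` {d..})"
    proof (rule boundedI)
      fix y assume "y \<in> ?g ` {d..}"
      then obtain t where t: "t \<ge> d" "y = ?g t" by auto
      have "(1 + t) / t \<le> (1 + d) / d" using t(1) d by (simp add: field_simps)
      then show "norm y \<le> ((1 + d) / d) ^ m"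
        using t d by (simp add: power_abs power_mono)
    qed
  qed auto
  then have "(\<lambda>t. ?g t * (t ^ m * exp (c * t) * \<eta> t)) integrable_on {d..}"
    by (rule set_lebesgue_integral_eq_integral(1))
  then show ?thesis
    by (rule integrable_eq) (use d in \<open>auto simp: power_divide\<close>)
qed

text \<open>If all real parts had the sign opposite to \<open>\<sigma>\<close>, the flow would tend to \<open>0\<close> in the time direction
  \<open>\<sigma>\<close>. Writing \<open>v\<close> as \<open>X(\<sigma>t)\<close> applied to a point of its bounded orbit would then give \<open>v = 0\<close>.\<close>

lemma (in linear_flow) bounded_orbit_imp_exponents:
  assumes growth: "\<And>t. norm (X t) \<le> K * growth bs t"
    and v: "v \<in> bounded_orbits" "v \<noteq> 0" and \<sigma>: "\<bar>\<sigma>\<bar> = 1"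
  shows "\<exists>(m, \<mu>)\<in>set bs. 0 \<le> \<sigma> * Re \<mu>"
proof (rule ccontr)
  assume "\<not> ?thesis"
  then have neg: "\<And>m \<mu>. (m, \<mu>) \<in> set bs \<Longrightarrow> \<sigma> * Re \<mu> < 0" by force
  obtain M where M: "\<And>t. norm (X t v) \<le> M"
    using v(1) by (auto simp: bounded_orbits_def)
  have "norm v \<le> K * growth bs (\<sigma> * t) * M" for t
  proof -
    have "norm v = norm (X (\<sigma> * t) (X (- (\<sigma> * t)) v))" by simp
    also have "\<dots> \<le> norm (X (\<sigma> * t)) * norm (X (- (\<sigma> * t)) v)" by (rule norm_blinfun)
    also have "\<dots> \<le> (K * growth bs (\<sigma> * t)) * M"
      by (intro mult_mono growth M) (auto intro: order_trans[OF norm_ge_zero growth])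
    finally show ?thesis .
  qed
  moreover have "((\<lambda>t. K * growth bs (\<sigma> * t) * M) \<longlongrightarrow> K * 0 * M) at_top"
    by (intro tendsto_mult tendsto_const growth_tendsto_0 \<sigma> neg)
  ultimately have "norm v \<le> K * 0 * M"
    by (intro tendsto_lowerbound[of _ _ at_top]) auto
  then show False using v(2) by simp
qed

text \<open>The nonzero bounded orbit is used in both time directions: it yields an eigenvalue in each of the
  two closed half-planes, that is, \<open>\<alpha> \<le> 0 \<le> \<beta>\<close>.\<close>

lemma flow_backward_bound:
  fixes C :: "real^'n^'n"
  assumes nf: "jordan_nf (complex_mat_of C) bs"
    and flow: "linear_flow (Blinfun ((*v) C)) X" and growth: "\<And>t. norm (X t) \<le> K * growth bs t"
    and v: "v \<in> linear_flow.bounded_orbits X" "v \<noteq> 0"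
  defines "\<alpha> \<equiv> Min (Re ` eigenvalues C)" and "\<beta> \<equiv> Max (Re ` eigenvalues C)"
  shows "\<exists>L\<ge>0. \<forall>t s. 0 \<le> t \<longrightarrow> t \<le> s \<longrightarrow> norm (X (t - s)) \<le>
    L * ((1 + s) ^ (max_divisor_degree C \<beta> + max_divisor_degree C \<alpha> - 2) * exp ((\<beta> - \<alpha>) * s))"
proof -
  interpret linear_flow "Blinfun ((*v) C)" X by (rule flow)
  have ev: "Re ` eigenvalues C = (Re \<circ> snd) ` set bs"
    unfolding eigenvalues_jordan_nf[OF nf] by (simp add: image_comp)
  obtain m1 \<mu>1 m2 \<mu>2 where \<mu>: "(m1, \<mu>1) \<in> set bs" "0 \<le> Re \<mu>1" "(m2, \<mu>2) \<in> set bs" "Re \<mu>2 \<le> 0"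
    using bounded_orbit_imp_exponents[OF growth v, of 1] bounded_orbit_imp_exponents[OF growth v, of "-1"]
    by auto
  have fin: "finite (Re ` eigenvalues C)" and ne: "Re ` eigenvalues C \<noteq> {}"
    unfolding ev using \<mu>(1) by auto
  have bd: "\<alpha> \<le> Re \<mu>" "Re \<mu> \<le> \<beta>" if "(m, \<mu>) \<in> set bs" for m \<mu>
  proof -
    have "Re \<mu> \<in> Re ` eigenvalues C" unfolding ev using that by force
    then show "\<alpha> \<le> Re \<mu>" "Re \<mu> \<le> \<beta>" unfolding \<alpha>_def \<beta>_def using fin by auto
  qed
  have deg1: "max_divisor_degree C r \<ge> 1" if "r \<in> Re ` eigenvalues C" for r
    using that block_size_le_max_divisor_degree[OF nf] unfolding ev by fastforce
  have "\<alpha> \<in> Re ` eigenvalues C" "\<beta> \<in> Re ` eigenvalues C"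
    unfolding \<alpha>_def \<beta>_def using fin ne by auto
  from deg1[OF this(1)] deg1[OF this(2)]
  have "\<exists>L\<ge>0. \<forall>t s. 0 \<le> t \<longrightarrow> t \<le> s \<longrightarrow> growth bs (t - s) \<le>
      L * ((1 + s) ^ (max_divisor_degree C \<beta> + max_divisor_degree C \<alpha> - 2) * exp ((\<beta> - \<alpha>) * s))"
    using bd \<mu> block_size_le_max_divisor_degree(1)[OF nf]
    by (intro growth_backward_bound) (auto intro: order_trans)
  then obtain L where L: "L \<ge> 0" "\<And>t s. 0 \<le> t \<Longrightarrow> t \<le> s \<Longrightarrow> growth bs (t - s) \<le>
      L * ((1 + s) ^ (max_divisor_degree C \<beta> + max_divisor_degree C \<alpha> - 2) * exp ((\<beta> - \<alpha>) * s))"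
    by blast
  have "norm (X (t - s)) \<le> (\<bar>K\<bar> * L) *
      ((1 + s) ^ (max_divisor_degree C \<beta> + max_divisor_degree C \<alpha> - 2) * exp ((\<beta> - \<alpha>) * s))"
    if ts: "0 \<le> t" "t \<le> s" for t s
  proof -
    have "norm (X (t - s)) \<le> \<bar>K\<bar> * growth bs (t - s)"
      using growth[of "t - s"] mult_right_mono[OF abs_ge_self[of K] growth_nonneg[of bs "t - s"]]
      by linarith
    also have "\<dots> \<le> \<bar>K\<bar> * (L *
      ((1 + s) ^ (max_divisor_degree C \<beta> + max_divisor_degree C \<alpha> - 2) * exp ((\<beta> - \<alpha>) * s)))"
      by (intro mult_left_mono L(2) ts) auto
    finally show ?thesis by (simp only: mult.assoc)
  qed
  then show ?thesis using L(1) by (intro exI[of _ "\<bar>K\<bar> * L"]) auto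
qed

section \<open>The perturbed system\<close>

theorem corollary3p1:
  fixes C :: "real^'n^'n"
    and f :: "real \<times> (real^'n) \<Rightarrow> real^'n"
    and \<eta> :: "real \<Rightarrow> real"
    and \<alpha> \<beta> :: real
    and m\<^sub>\<alpha> m\<^sub>\<beta> k :: nat
    and \<gamma>\<^sub>1 :: "(real \<Rightarrow> real^'n) set"
  assumes f_cont: "continuous_on UNIV f"
    and f_zero: "\<And>t. f (t, 0) = 0"
    and alpha: "\<alpha> = Min (Re ` eigenvalues C)"
    and beta: "\<beta> = Max (Re ` eigenvalues C)"
    and m_alpha: "m\<^sub>\<alpha> = max_divisor_degree C \<alpha>"
    and m_beta: "m\<^sub>\<beta> = max_divisor_degree C \<beta>"
    and eta_nonneg: "\<And>t. t \<ge> 0 \<Longrightarrow> \<eta> t \<ge> 0"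
    and f_lipschitz: "\<And>t x\<^sub>1 x\<^sub>2. t \<ge> 0 \<Longrightarrow>
          norm (f (t, x\<^sub>1) - f (t, x\<^sub>2)) \<le> \<eta> t * norm (x\<^sub>1 - x\<^sub>2)"
    and eta_integrable:
          "(\<lambda>t. t ^ (m\<^sub>\<beta> + m\<^sub>\<alpha> - 2) * exp ((\<beta> - \<alpha>) * t) * \<eta> t) integrable_on {0..}"
    and eta_limit:
          "((\<lambda>t. integral {t..} (\<lambda>s. (s - t) ^ (m\<^sub>\<alpha> - 1) * s ^ (m\<^sub>\<beta> - 1)
                * exp (\<alpha> * (t - s)) * exp (\<beta> * s) * \<eta> s)) \<longlongrightarrow> 0) at_top"
    and k_le: "k \<le> CARD('n)"
    and gamma1_sols: "\<gamma>\<^sub>1 \<subseteq> ap_solutions (\<lambda>t x. C *v x)"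
    and gamma1_family: "parameter_family k (compact_open_topology UNIV) \<gamma>\<^sub>1"
  shows "\<exists>\<gamma>\<^sub>2. \<gamma>\<^sub>2 \<subseteq> aap_solutions (\<lambda>t y. C *v y + f (t, y)) \<and>
           parameter_family k (compact_open_topology {0..}) \<gamma>\<^sub>2 \<and>
           subtopology (compact_open_topology UNIV) \<gamma>\<^sub>1
             homeomorphic_space subtopology (compact_open_topology {0..}) \<gamma>\<^sub>2"
proof -
  let ?F = "\<lambda>t y. C *v y + f (t, y)"
  \<comment> \<open>A homeomorphism transports the parametrization, so that only the solutions have to be found.\<close>
  have suffices: ?thesis
    if "\<gamma>\<^sub>2 \<subseteq> aap_solutions ?F" "subtopology (compact_open_topology UNIV) \<gamma>\<^sub>1
         homeomorphic_space subtopology (compact_open_topology {0..}) \<gamma>\<^sub>2" for \<gamma>\<^sub>2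
  proof -
    have "\<gamma>\<^sub>2 \<subseteq> topspace (compact_open_topology {0..})"
      using that(1) solves_ode_on_continuous_on
      by (auto simp: aap_solutions_def continuous_functions_def)
    then show ?thesis
      using that parameter_family_homeomorphic[OF gamma1_family] by blast
  qed
  obtain bs where nf: "jordan_nf (complex_mat_of C) bs"
    by (rule complex_mat_of_jordan_nf)
  obtain X K where flow: "linear_flow (Blinfun ((*v) C)) X" and growth: "\<And>t. norm (X t) \<le> K * growth bs t"
    by (rule complex_mat_of_flow[OF nf]) blast
  interpret linear_flow "Blinfun ((*v) C)" X by (rule flow)
  have C_apply: "Blinfun ((*v) C) v = C *v v" for v
    by (simp add: bounded_linear_Blinfun_apply matrix_vector_mul_bounded_linear)
  have orbit: "x = (\<lambda>t. X t (x 0))" and x_ap: "almost_periodic x" and x_B: "x 0 \<in> bounded_orbits"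
    if "x \<in> \<gamma>\<^sub>1" for x
  proof -
    have x: "\<And>t. (x has_vector_derivative C *v x t) (at t)" and ap: "almost_periodic x"
      using gamma1_sols that by (auto simp: ap_solutions_def solves_ode_on_def)
    show "almost_periodic x" by (rule ap)
    show eq: "x = (\<lambda>t. X t (x 0))"
      by (rule ext, rule solution_eq_flow) (simp add: C_apply x)
    show "x 0 \<in> bounded_orbits"
      using almost_periodic_bounded[OF ap] unfolding bounded_orbits_def mem_Collect_eq fun_cong[OF eq, symmetric] .
  qed
  define S\<^sub>0 where "S\<^sub>0 = (\<lambda>x. x 0) ` \<gamma>\<^sub>1"
  have S0: "S\<^sub>0 \<subseteq> bounded_orbits" using x_B by (auto simp: S\<^sub>0_def)
  have \<gamma>1: "\<gamma>\<^sub>1 = (\<lambda>a t. X t a) ` S\<^sub>0"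
  proof -
    have "(\<lambda>x t. X t (x 0)) ` \<gamma>\<^sub>1 = (\<lambda>x. x) ` \<gamma>\<^sub>1"
      by (rule image_cong[OF refl], rule orbit[symmetric])
    then show ?thesis by (simp add: S\<^sub>0_def image_image)
  qed
  have "\<gamma>\<^sub>1 \<noteq> {}" using gamma1_family by (auto simp: parameter_family_def)
  show ?thesis
  proof (cases "S\<^sub>0 \<subseteq> {0}")
    case True
    then have "S\<^sub>0 = {0}" using \<open>\<gamma>\<^sub>1 \<noteq> {}\<close> by (auto simp: S\<^sub>0_def)
    then have "\<gamma>\<^sub>1 = {\<lambda>_. 0}" unfolding \<gamma>1 by (simp add: blinfun.zero_right)
    then show ?thesis
      using suffices[OF zero_solution_family(1)[of ?F]] zero_solution_family(2)[of ?F] f_zero by simp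
  next
    case False
    then obtain v where v: "v \<in> bounded_orbits" "v \<noteq> 0" using S0 by blast
    obtain L where L: "L \<ge> 0" "\<And>t s. 0 \<le> t \<Longrightarrow> t \<le> s \<Longrightarrow>
        norm (X (t - s)) \<le> L * ((1 + s) ^ (m\<^sub>\<beta> + m\<^sub>\<alpha> - 2) * exp ((\<beta> - \<alpha>) * s))"
      using flow_backward_bound[OF nf flow growth v] unfolding m_alpha m_beta alpha beta by blast
    define w where "w s = L * ((1 + s) ^ (m\<^sub>\<beta> + m\<^sub>\<alpha> - 2) * exp ((\<beta> - \<alpha>) * s) * \<eta> s)" for s
    interpret perturbed_flow "Blinfun ((*v) C)" X w f
    proof
      show "w integrable_on {d..}" if "d > 0" for d
        unfolding w_def using shifted_power_integrable[OF eta_nonneg eta_integrable that]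
        by (rule integrable_on_mult_right)
      show "w t \<ge> 0" if "t > 0" for t
        using that L(1) eta_nonneg[of t] by (simp add: w_def)
      fix t s :: real and y z :: "real^'n"
      assume ts: "0 \<le> t" "t \<le> s"
      have "norm (X (t - s) (f (s, y) - f (s, z))) \<le> norm (X (t - s)) * norm (f (s, y) - f (s, z))"
        by (rule norm_blinfun)
      also have "\<dots> \<le> L * ((1 + s) ^ (m\<^sub>\<beta> + m\<^sub>\<alpha> - 2) * exp ((\<beta> - \<alpha>) * s)) * (\<eta> s * norm (y - z))"
        using ts L(1) by (intro mult_mono L(2) f_lipschitz) auto
      finally show "norm (X (t - s) (f (s, y) - f (s, z))) \<le> w s * norm (y - z)"
        by (simp add: w_def mult.assoc)
    qed (use f_cont f_zero in auto)
    obtain r Y where r: "r > 0"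
      and Y: "\<And>a. a \<in> bounded_orbits \<inter> cball 0 r \<Longrightarrow> solves_ode_on {0..} ?F (Y a)"
        "\<And>a. a \<in> bounded_orbits \<inter> cball 0 r \<Longrightarrow> Y a \<in> extensional {0..}"
        "\<And>a. a \<in> bounded_orbits \<inter> cball 0 r \<Longrightarrow> ((\<lambda>t. Y a t - X t a) \<longlongrightarrow> 0) at_top"
      and hom: "\<And>S. S \<subseteq> bounded_orbits \<inter> cball 0 r \<Longrightarrow>
          top_of_set S homeomorphic_space subtopology (compact_open_topology {0..}) (Y ` S)"
      using solution_family unfolding C_apply by blast
    define S where "S = (\<lambda>v. (r / (1 + norm v)) *\<^sub>R v) ` S\<^sub>0"
    have S: "S \<subseteq> bounded_orbits \<inter> cball 0 r"
    proof
      fix a assume "a \<in> S"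
      then obtain v where v: "v \<in> S\<^sub>0" "a = (r / (1 + norm v)) *\<^sub>R v" by (auto simp: S_def)
      have "r * norm v \<le> r * (1 + norm v)" using r by (intro mult_left_mono) auto
      moreover have "1 + norm v > 0" using norm_ge_zero[of v] by linarith
      ultimately have "norm a \<le> r" using r by (simp add: v(2) divide_le_eq)
      moreover have "a \<in> bounded_orbits" using v S0 real_vector.subspace_scale[OF subspace_bounded_orbits] by auto
      ultimately show "a \<in> bounded_orbits \<inter> cball 0 r" by simp
    qed
    have ap: "almost_periodic (\<lambda>t. X t a)" if "a \<in> S" for a
    proof -
      obtain x c where x: "x \<in> \<gamma>\<^sub>1" "a = c *\<^sub>R x 0" using \<open>a \<in> S\<close> by (auto simp: S_def S\<^sub>0_def)
      have "(\<lambda>t. X t a) = (\<lambda>t. c *\<^sub>R x t)"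
        unfolding x(2) blinfun.scaleR_right fun_cong[OF orbit[OF x(1)], symmetric] ..
      then show ?thesis using almost_periodic_scaleR[OF x_ap[OF x(1)]] by simp
    qed
    have "Y ` S \<subseteq> aap_solutions ?F"
    proof
      fix y assume "y \<in> Y ` S"
      then obtain a where a: "a \<in> S" "y = Y a" by blast
      note Ya = Y[OF subsetD[OF S a(1)]]
      show "y \<in> aap_solutions ?F"
        unfolding aap_solutions_def a(2)
        using Ya asymptotically_almost_periodic_restrict[OF ap[OF a(1)] solves_ode_on_continuous_on[OF Ya(1)] Ya(2,3)]
        by simp
    qed
    moreover have "subtopology (compact_open_topology UNIV) \<gamma>\<^sub>1
        homeomorphic_space subtopology (compact_open_topology {0..}) (Y ` S)"
      using flow_homeomorphic_initial_values[OF S0] homeomorphic_shrink_into_ball[OF r, of S\<^sub>0] hom[OF S]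
      unfolding \<gamma>1 S_def
      by (meson homeomorphic_space_sym homeomorphic_space_trans)
    ultimately show ?thesis by (rule suffices)
  qed
qed

end
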